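(* Let $n\in\mathbb N$, $t_0\in\mathbb R$, let $\tilde x_0\in\mathcal R_c^n$ be a compactly supported generalized point of $\mathbb R^n$, and let $F=[(F_\varepsilon)_\varepsilon]\in\mathcal G(\mathbb R^n)^n$ satisfy: (i) there exist $C,\varepsilon_0>0$ such that $|F_\varepsilon(x)|\le C(1+|x|)$ for all $x\in\mathbb R^n$ and all $\varepsilon<\varepsilon_0$; and (ii) $|\nabla F|$ is locally of $L^\infty$-log-type, i.e. for every compact $K\subset\mathbb R^n$, $\sup_{x\in K}|\nabla F_\varepsilon(x)|=O(|\log\varepsilon|)$ as $\varepsilon\to0$. Then the initial value problem $$\dot x(t)=F(x(t)),\qquad x(t_0)=\tilde x_0$$ has a unique solution $x$ in $\mathcal G[\mathbb R,\mathbb R^n]$. Moreover, $\dot x$ is c-bounded.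
   Context: Let $I=(0,1]$; all $O(\cdot)$ are for $\varepsilon\to0$. $\mathcal E_M(\mathbb R^d)$ is the set of nets $(u_\varepsilon)_{\varepsilon\in I}$ in $C^\infty(\mathbb R^d)$ such that for every compact $K$ and every multi-index $\alpha$ there is $N\in\mathbb N$ with $\sup_K|\partial^\alpha u_\varepsilon|=O(\varepsilon^{-N})$. $\mathcal N(\mathbb R^d)$ is the set of $(u_\varepsilon)_\varepsilon\in\mathcal E_M(\mathbb R^d)$ such that for every compact $K$ and every $q\in\mathbb N_0$, $\sup_K|u_\varepsilon|=O(\varepsilon^q)$. The (special) Colombeau algebra is $\mathcal G(\mathbb R^d)=\mathcal E_M(\mathbb R^d)/\mathcal N(\mathbb R^d)$, and classes are written $u=[(u_\varepsilon)_\varepsilon]$. Derivatives are defined on representatives. $\mathcal R_c^n$ is the set of nets $(x_\varepsilon)_{\varepsilon\in I}$ in $\mathbb R^n$ that lie in some fixed compact set for all small $\varepsilon$, modulo the relation $|x_\varepsilon-y_\varepsilon|=O(\varepsilon^m)$ for every $m>0$. A net of maps $u_\varepsilon\in C^\infty(\mathbb R^d,\mathbb R^n)$ is c-bounded if for each compact $K\subset\mathbb R^d$ there are $\varepsilon_0>0$ and a compact $K'\subset\mathbb R^n$ with $u_\varepsilon(K)\subseteq K'$ for all $\varepsilon<\varepsilon_0$. $\mathcal G[\mathbb R^d,\mathbb R^n]$ is the space of c-bounded generalized functions: c-bounded nets with components in $\mathcal E_M(\mathbb R^d)$, modulo nets whose difference has components in $\mathcal N(\mathbb R^d)$. A generalized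 function is called c-bounded if its representatives are c-bounded nets. For $x=[(x_\varepsilon)_\varepsilon]\in\mathcal G[\mathbb R,\mathbb R^n]$ the composition $F\circ x:=[(F_\varepsilon\circ x_\varepsilon)_\varepsilon]$ is a well-defined element of $\mathcal G(\mathbb R)^n$. The differential equation means equality $[(\dot x_\varepsilon)_\varepsilon]=[(F_\varepsilon\circ x_\varepsilon)_\varepsilon]$ in $\mathcal G(\mathbb R)^n$, and the initial condition means $[(x_\varepsilon(t_0))_\varepsilon]=\tilde x_0$ in $\mathcal R_c^n$. Condition (i) is a condition on some representative $(F_\varepsilon)_\varepsilon$ of $F$. *)

theory Defs
  imports "HOL-Analysis.Analysis" "HOL-Library.Landau_Symbols"
begin

text \<open>
  Nets indexed by \<open>I = (0, 1]\<close> are modelled as total functions of a real index. Every condition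
  below only looks at indices in \<open>I\<close>, so values outside \<open>I\<close> are irrelevant and are identified by
  the quotients. Asymptotics for \<open>\<epsilon> \<rightarrow> 0\<close> are taken along the filter \<^term>\<open>at_right (0::real)\<close>.
\<close>

abbreviation index_set :: "real set" where
  "index_set \<equiv> {0<..1}"

type_synonym ('a, 'b) net = "real \<Rightarrow> 'a \<Rightarrow> 'b"

text \<open>
  A multi-index is given by a list of basis vectors, in which \<open>b\<close> occurs \<open>\<alpha>\<^sub>b\<close> times. For smooth
  functions the order of differentiation is immaterial, so these lists yield exactly the
  derivatives \<open>\<partial>\<^sup>\<alpha>\<close>.
\<close>

primrec partial_deriv :: "'a::euclidean_space list \<Rightarrow> ('a \<Rightarrow> real) \<Rightarrow> 'a \<Rightarrow> real" where
  "partial_deriv [] f = f"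
| "partial_deriv (b # bs) f = (\<lambda>x. frechet_derivative (partial_deriv bs f) (at x) b)"

definition smooth :: "('a::euclidean_space \<Rightarrow> real) \<Rightarrow> bool" where
  "smooth f \<longleftrightarrow> (\<forall>bs. set bs \<subseteq> Basis \<longrightarrow> partial_deriv bs f differentiable_on UNIV)"

text \<open>
  Compact sets are required to be nonempty wherever a supremum over them is formed, since the
  supremum of the empty set of reals is unspecified.
\<close>

definition moderate :: "('a::euclidean_space, real) net set" where
  "moderate = {u. (\<forall>\<epsilon>\<in>index_set. smooth (u \<epsilon>)) \<and>
     (\<forall>K bs. compact K \<longrightarrow> K \<noteq> {} \<longrightarrow> set bs \<subseteq> Basis \<longrightarrow>
        (\<exists>N::nat. (\<lambda>\<epsilon>. SUP x\<in>K. \<bar>partial_deriv bs (u \<epsilon>) x\<bar>) \<in> O[at_right 0](\<lambda>\<epsilon>. 1 / \<epsilon> ^ N)))}"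

definition negligible_nets :: "('a::euclidean_space, real) net set" where
  "negligible_nets = {u \<in> moderate. \<forall>K. compact K \<longrightarrow> K \<noteq> {} \<longrightarrow>
     (\<forall>q::nat. (\<lambda>\<epsilon>. SUP x\<in>K. \<bar>u \<epsilon> x\<bar>) \<in> O[at_right 0](\<lambda>\<epsilon>. \<epsilon> ^ q))}"

definition colombeau_rel :: "(('a::euclidean_space, real) net \<times> ('a, real) net) set" where
  "colombeau_rel = {(u, v). u \<in> moderate \<and> v \<in> moderate \<and>
     (\<lambda>\<epsilon> x. u \<epsilon> x - v \<epsilon> x) \<in> negligible_nets}"

definition colombeau :: "('a::euclidean_space, real) net set set" where
  "colombeau = moderate // colombeau_rel"

definition colombeau_class :: "('a::euclidean_space, real) net \<Rightarrow> ('a, real) net set" where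
  "colombeau_class u = colombeau_rel `` {u}"

definition component :: "'n \<Rightarrow> ('a, real ^ 'n) net \<Rightarrow> ('a, real) net" where
  "component i u = (\<lambda>\<epsilon> x. u \<epsilon> x $ i)"

text \<open>The power \<open>\<G>(\<real>\<^sup>d)\<^sup>n\<close>, and the nets of maps representing one of its elements.\<close>

definition colombeau_vec :: "(('a::euclidean_space, real) net set ^ 'n) set" where
  "colombeau_vec = {U. \<forall>i. U $ i \<in> colombeau}"

definition represents ::
    "('a::euclidean_space, real ^ 'n) net \<Rightarrow> ('a, real) net set ^ 'n \<Rightarrow> bool" where
  "represents u U \<longleftrightarrow> (\<forall>i. component i u \<in> U $ i)"

definition compact_nets :: "(real \<Rightarrow> real ^ 'n) set" where
  "compact_nets = {x. \<exists>K. compact K \<and> (\<forall>\<^sub>F \<epsilon> in at_right 0. x \<epsilon> \<in> K)}"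

definition point_rel :: "((real \<Rightarrow> real ^ 'n) \<times> (real \<Rightarrow> real ^ 'n)) set" where
  "point_rel = {(x, y). x \<in> compact_nets \<and> y \<in> compact_nets \<and>
     (\<forall>m::real. m > 0 \<longrightarrow> (\<lambda>\<epsilon>. norm (x \<epsilon> - y \<epsilon>)) \<in> O[at_right 0](\<lambda>\<epsilon>. \<epsilon> powr m))}"

definition generalized_points :: "(real \<Rightarrow> real ^ 'n) set set" where
  "generalized_points = compact_nets // point_rel"

definition c_bounded :: "('a::euclidean_space, real ^ 'n) net \<Rightarrow> bool" where
  "c_bounded u \<longleftrightarrow> (\<forall>K. compact K \<longrightarrow>
     (\<exists>\<epsilon>\<^sub>0>0. \<exists>K'. compact K' \<and> (\<forall>\<epsilon>\<in>index_set. \<epsilon> < \<epsilon>\<^sub>0 \<longrightarrow> u \<epsilon> ` K \<subseteq> K')))"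

definition c_bounded_nets :: "('a::euclidean_space, real ^ 'n) net set" where
  "c_bounded_nets = {u. c_bounded u \<and> (\<forall>i. component i u \<in> moderate)}"

definition c_bounded_rel ::
    "(('a::euclidean_space, real ^ 'n) net \<times> ('a, real ^ 'n) net) set" where
  "c_bounded_rel = {(u, v). u \<in> c_bounded_nets \<and> v \<in> c_bounded_nets \<and>
     (\<forall>i. component i (\<lambda>\<epsilon> x. u \<epsilon> x - v \<epsilon> x) \<in> negligible_nets)}"

definition c_bounded_colombeau :: "('a::euclidean_space, real ^ 'n) net set set" where
  "c_bounded_colombeau = c_bounded_nets // c_bounded_rel"

definition c_bounded_gf :: "('a::euclidean_space, real) net set ^ 'n \<Rightarrow> bool" where
  "c_bounded_gf U \<longleftrightarrow> U \<in> colombeau_vec \<and> (\<forall>u. represents u U \<longrightarrow> c_bounded u)"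

text \<open>
  Operations are defined on representatives. Each union ranges over the classes obtained from all
  choices of representatives; these coincide, so the union is that common class.
\<close>

definition generalized_deriv :: "(real, real ^ 'n) net set \<Rightarrow> (real, real) net set ^ 'n" where
  "generalized_deriv X = (\<chi> i. \<Union>x\<in>X.
     colombeau_class (component i (\<lambda>\<epsilon> t. vector_derivative (x \<epsilon>) (at t))))"

definition gcompose ::
    "(real ^ 'n, real) net set ^ 'n \<Rightarrow> (real, real ^ 'n) net set \<Rightarrow> (real, real) net set ^ 'n" where
  "gcompose F X = (\<chi> i. \<Union>f\<in>F $ i. \<Union>x\<in>X. colombeau_class (\<lambda>\<epsilon>. f \<epsilon> \<circ> x \<epsilon>))"

definition point_value :: "(real, real ^ 'n) net set \<Rightarrow> real \<Rightarrow> (real \<Rightarrow> real ^ 'n) set" where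
  "point_value X t = (\<Union>x\<in>X. point_rel `` {\<lambda>\<epsilon>. x \<epsilon> t})"

definition linear_growth :: "(real ^ 'n, real) net set ^ 'n \<Rightarrow> bool" where
  "linear_growth F \<longleftrightarrow> (\<exists>f. represents f F \<and>
     (\<exists>C>0. \<exists>\<epsilon>\<^sub>0>0. \<forall>\<epsilon>\<in>index_set. \<epsilon> < \<epsilon>\<^sub>0 \<longrightarrow> (\<forall>x. norm (f \<epsilon> x) \<le> C * (1 + norm x))))"

text \<open>
  The norm of the Jacobian is that of \<^typ>\<open>real ^ 'n ^ 'n\<close>, i.e. the Frobenius norm. The condition
  does not depend on the representative, because derivatives of negligible nets are negligible.
\<close>

definition gradient_log_type :: "(real ^ 'n, real) net set ^ 'n \<Rightarrow> bool" where
  "gradient_log_type F \<longleftrightarrow> (\<exists>f. represents f F \<and> (\<forall>K. compact K \<longrightarrow> K \<noteq> {} \<longrightarrow>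
     (\<lambda>\<epsilon>. SUP x\<in>K. norm (jacobian (f \<epsilon>) (at x))) \<in> O[at_right 0](\<lambda>\<epsilon>. \<bar>ln \<epsilon>\<bar>)))"

definition solves_ivp ::
    "(real ^ 'n, real) net set ^ 'n \<Rightarrow> real \<Rightarrow> (real \<Rightarrow> real ^ 'n) set \<Rightarrow>
     (real, real ^ 'n) net set \<Rightarrow> bool" where
  "solves_ivp F t\<^sub>0 x\<^sub>0 X \<longleftrightarrow> X \<in> c_bounded_colombeau \<and>
     generalized_deriv X = gcompose F X \<and> point_value X t\<^sub>0 = x\<^sub>0"

end

theory Submission imports Defs begin

text \<open>
  Fixing a representative of \<open>F\<close> with linear growth, the equation is solved classically for every
  \<open>\<epsilon>\<close>. Gronwall's inequality turns the growth bound, which is uniform in \<open>\<epsilon>\<close>, into c-boundedness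
  of the net of solutions; the equation itself then bounds all derivatives inductively, so this net
  is moderate. For two solutions \<open>x\<close>, \<open>y\<close> the difference satisfies
  \<open>\<bar>(x - y)'\<bar> \<le> c * \<bar>ln \<epsilon>\<bar> * \<bar>x - y\<bar> + n\<close> with \<open>n\<close> negligible, and Gronwall costs only the factor
  \<open>exp (c * T * \<bar>ln \<epsilon>\<bar>)\<close>, a fixed negative power of \<open>\<epsilon>\<close>, so \<open>x - y\<close> is negligible.
\<close>

section \<open>Estimates of nets\<close>

text \<open>The hypotheses concern some representative of \<open>F\<close>, possibly one for the
  growth bound and another for the gradient, and a solution is a class whose members solve the
  equation only up to a negligible error. Hence \<open>solves_ivp_iff\<close> precedes the analysis:
  the problem may be tested on any representatives of \<open>F\<close>, of the initial value and of
  the solution. The obstacle there is differentiation. Equality of classes controls the difference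
  of two nets at order zero only, whereas \<open>generalized_deriv\<close> needs the derivative of
  that difference to be negligible; a moderate second derivative makes interpolation possible
  (\<open>rapidly_small_partial_deriv\<close>). The classical problem for one \<epsilon> is not
  immediate either, since the field is merely locally Lipschitz. It is cut off outside a ball whose
  radius is the a priori bound, solved by a contraction on the whole line, and the solutions on
  growing intervals are glued by uniqueness. The Lipschitz constants used there may depend on
  \<epsilon> in any way; only the growth constant enters the bound that makes the solutions
  c-bounded.\<close>

definition moderately_bounded :: "('a::euclidean_space, 'b::real_normed_vector) net \<Rightarrow> bool" where
  "moderately_bounded u \<longleftrightarrow> (\<forall>K. compact K \<longrightarrow>
     (\<exists>N::nat. \<forall>\<^sub>F \<epsilon> in at_right 0. \<forall>x\<in>K. norm (u \<epsilon> x) \<le> 1 / \<epsilon> ^ N))"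

text \<open>As in \<open>moderately_bounded\<close>, the constant of the O-estimate is absorbed by
  changing the exponent, and points of \<open>K\<close> replace the supremum. So the estimates make
  sense for vector-valued nets and for empty \<open>K\<close>.\<close>

definition rapidly_small :: "('a::euclidean_space, 'b::real_normed_vector) net \<Rightarrow> bool" where
  "rapidly_small u \<longleftrightarrow> (\<forall>K. compact K \<longrightarrow>
     (\<forall>q::nat. \<forall>\<^sub>F \<epsilon> in at_right 0. \<forall>x\<in>K. norm (u \<epsilon> x) \<le> \<epsilon> ^ q))"

lemma eventually_at_right_0_less:
  fixes c :: real
  assumes "c > 0"
  shows "\<forall>\<^sub>F \<epsilon> in at_right 0. 0 < \<epsilon> \<and> \<epsilon> < c"
  using eventually_at_right_real[OF assms] by simp

lemma eventually_index_set: "\<forall>\<^sub>F \<epsilon> in at_right (0::real). \<epsilon> \<in> index_set"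
  using eventually_at_right_0_less[OF zero_less_one] by (auto elim: eventually_mono)

text \<open>A supremum of reals bounds its members only if the set is bounded above. In one
  direction continuity on the compact set provides this; in the other the pointwise estimate itself
  does.\<close>

lemma bigo_SUP_iff:
  fixes g :: "real \<Rightarrow> 'a::euclidean_space \<Rightarrow> real"
  assumes "compact K" "K \<noteq> {}" "\<forall>\<^sub>F \<epsilon> in F. continuous_on K (g \<epsilon>)"
  shows "(\<lambda>\<epsilon>. SUP x\<in>K. \<bar>g \<epsilon> x\<bar>) \<in> O[F](h) \<longleftrightarrow>
    (\<exists>c. \<forall>\<^sub>F \<epsilon> in F. \<forall>x\<in>K. \<bar>g \<epsilon> x\<bar> \<le> c * \<bar>h \<epsilon>\<bar>)"
proof
  assume "(\<lambda>\<epsilon>. SUP x\<in>K. \<bar>g \<epsilon> x\<bar>) \<in> O[F](h)"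
  then obtain c where "\<forall>\<^sub>F \<epsilon> in F. norm (SUP x\<in>K. \<bar>g \<epsilon> x\<bar>) \<le> c * norm (h \<epsilon>)"
    by (rule landau_o.bigE)
  with assms(3) have "\<forall>\<^sub>F \<epsilon> in F. \<forall>x\<in>K. \<bar>g \<epsilon> x\<bar> \<le> c * \<bar>h \<epsilon>\<bar>"
  proof eventually_elim
    case (elim \<epsilon>)
    have "bdd_above ((\<lambda>x. \<bar>g \<epsilon> x\<bar>) ` K)"
      by (intro bounded_imp_bdd_above compact_imp_bounded compact_continuous_image assms
          continuous_intros elim)
    then have "\<bar>g \<epsilon> x\<bar> \<le> (SUP x\<in>K. \<bar>g \<epsilon> x\<bar>)" if "x \<in> K" for x
      using that by (rule cSUP_upper[rotated])
    then show ?case using elim by fastforce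
  qed
  then show "\<exists>c. \<forall>\<^sub>F \<epsilon> in F. \<forall>x\<in>K. \<bar>g \<epsilon> x\<bar> \<le> c * \<bar>h \<epsilon>\<bar>" by blast
next
  assume "\<exists>c. \<forall>\<^sub>F \<epsilon> in F. \<forall>x\<in>K. \<bar>g \<epsilon> x\<bar> \<le> c * \<bar>h \<epsilon>\<bar>"
  then obtain c where c: "\<forall>\<^sub>F \<epsilon> in F. \<forall>x\<in>K. \<bar>g \<epsilon> x\<bar> \<le> c * \<bar>h \<epsilon>\<bar>" by blast
  show "(\<lambda>\<epsilon>. SUP x\<in>K. \<bar>g \<epsilon> x\<bar>) \<in> O[F](h)"
  proof (rule bigoI[of _ c], rule eventually_mono[OF c])
    fix \<epsilon> assume elim: "\<forall>x\<in>K. \<bar>g \<epsilon> x\<bar> \<le> c * \<bar>h \<epsilon>\<bar>"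
    obtain x0 where "x0 \<in> K" using assms(2) by blast
    have bd: "bdd_above ((\<lambda>x. \<bar>g \<epsilon> x\<bar>) ` K)" using elim by (auto intro: bdd_aboveI2)
    \<comment> \<open>The O-estimate concerns the absolute value of the supremum, so a lower bound
      is needed as well; a point of \<open>K\<close> supplies it.\<close>
    have "0 \<le> (SUP x\<in>K. \<bar>g \<epsilon> x\<bar>)"
      by (rule order.trans[OF _ cSUP_upper[OF \<open>x0 \<in> K\<close> bd]]) simp
    moreover have "(SUP x\<in>K. \<bar>g \<epsilon> x\<bar>) \<le> c * \<bar>h \<epsilon>\<bar>"
      using elim by (intro cSUP_least assms) auto
    ultimately show "norm (SUP x\<in>K. \<bar>g \<epsilon> x\<bar>) \<le> c * norm (h \<epsilon>)" by simp
  qed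
qed

text \<open>One spare power of \<epsilon> outweighs any constant; \<open>1 + \<bar>c\<bar>\<close>
  in the threshold covers c = 0.\<close>

lemma eventually_const_mult_power:
  fixes c :: real
  shows "\<forall>\<^sub>F \<epsilon> in at_right 0. c * \<epsilon> ^ Suc q \<le> \<epsilon> ^ q"
proof -
  have "\<forall>\<^sub>F \<epsilon> in at_right 0. 0 < \<epsilon> \<and> \<epsilon> < 1 / (1 + \<bar>c\<bar>)"
    by (rule eventually_at_right_0_less) (simp add: add_pos_nonneg)
  then show ?thesis
  proof eventually_elim
    case (elim \<epsilon>)
    then have "\<epsilon> * (1 + \<bar>c\<bar>) < 1" by (simp add: field_simps)
    moreover have "c * \<epsilon> \<le> \<epsilon> * (1 + \<bar>c\<bar>)" using elim
      by (simp add: algebra_simps) (metis abs_ge_self add_increasing mult_left_mono mult.commute less_imp_le)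
    ultimately have "c * \<epsilon> \<le> 1" by linarith
    then have "c * \<epsilon> * \<epsilon> ^ q \<le> 1 * \<epsilon> ^ q" using elim by (intro mult_right_mono) auto
    then show ?case by (simp add: mult.assoc)
  qed
qed

lemma eventually_const_div_power:
  fixes c :: real
  shows "\<forall>\<^sub>F \<epsilon> in at_right 0. c / \<epsilon> ^ q \<le> 1 / \<epsilon> ^ Suc q"
  using eventually_const_mult_power[of c q] eventually_at_right_0_less[OF zero_less_one]
  by eventually_elim (auto simp: field_simps)

lemma eventually_power_antimono:
  assumes "p \<le> (q::nat)"
  shows "\<forall>\<^sub>F \<epsilon> in at_right (0::real). \<epsilon> ^ q \<le> \<epsilon> ^ p \<and> 1 / \<epsilon> ^ p \<le> 1 / \<epsilon> ^ q"
  using eventually_at_right_0_less[OF zero_less_one]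
  by eventually_elim (auto intro!: power_decreasing divide_left_mono assms)

lemma moderately_boundedI_const:
  assumes "\<And>K. compact K \<Longrightarrow> K \<noteq> {} \<Longrightarrow>
    \<exists>N c. \<forall>\<^sub>F \<epsilon> in at_right 0. \<forall>x\<in>K. norm (u \<epsilon> x) \<le> c / \<epsilon> ^ N"
  shows "moderately_bounded u"
  unfolding moderately_bounded_def
proof (intro allI impI)
  fix K :: "'a set" assume K: "compact K"
  show "\<exists>N::nat. \<forall>\<^sub>F \<epsilon> in at_right 0. \<forall>x\<in>K. norm (u \<epsilon> x) \<le> 1 / \<epsilon> ^ N"
  proof (cases "K = {}")
    case False
    then obtain N c where "\<forall>\<^sub>F \<epsilon> in at_right 0. \<forall>x\<in>K. norm (u \<epsilon> x) \<le> c / \<epsilon> ^ N"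
      using assms K by blast
    then have "\<forall>\<^sub>F \<epsilon> in at_right 0. \<forall>x\<in>K. norm (u \<epsilon> x) \<le> 1 / \<epsilon> ^ Suc N"
      using eventually_const_div_power[of c N]
      by eventually_elim (meson order.trans)
    then show ?thesis by blast
  qed simp
qed

lemma rapidly_smallI_const:
  assumes "\<And>K q. compact K \<Longrightarrow> K \<noteq> {} \<Longrightarrow>
    \<exists>c. \<forall>\<^sub>F \<epsilon> in at_right 0. \<forall>x\<in>K. norm (u \<epsilon> x) \<le> c * \<epsilon> ^ q"
  shows "rapidly_small u"
  unfolding rapidly_small_def
proof (intro allI impI)
  fix K :: "'a set" and q :: nat assume K: "compact K"
  show "\<forall>\<^sub>F \<epsilon> in at_right 0. \<forall>x\<in>K. norm (u \<epsilon> x) \<le> \<epsilon> ^ q"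
  proof (cases "K = {}")
    case False
    \<comment> \<open>Smallness is available for every exponent, so asking for one more costs
      nothing and pays for \<open>c\<close>.\<close>
    then obtain c where "\<forall>\<^sub>F \<epsilon> in at_right 0. \<forall>x\<in>K. norm (u \<epsilon> x) \<le> c * \<epsilon> ^ Suc q"
      using assms K by blast
    then show ?thesis using eventually_const_mult_power[of c q]
      by eventually_elim (meson order.trans)
  qed simp
qed

section \<open>Moderate and negligible nets as pointwise estimates\<close>

lemma smooth_continuous:
  assumes "smooth f" "set bs \<subseteq> Basis"
  shows "continuous_on S (partial_deriv bs f)"
  using assms differentiable_imp_continuous_on continuous_on_subset
  unfolding smooth_def by blast

text \<open>The smoothness conjunct gives the continuity required by \<open>bigo_SUP_iff\<close>;
  hence the second conjunct is rewritten under the first.\<close>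

lemma moderate_iff:
  "u \<in> moderate \<longleftrightarrow> (\<forall>\<epsilon>\<in>index_set. smooth (u \<epsilon>)) \<and>
    (\<forall>bs. set bs \<subseteq> Basis \<longrightarrow> moderately_bounded (\<lambda>\<epsilon>. partial_deriv bs (u \<epsilon>)))"
proof -
  define E where "E K bs \<longleftrightarrow>
    (\<exists>N::nat. (\<lambda>\<epsilon>. SUP x\<in>K. \<bar>partial_deriv bs (u \<epsilon>) x\<bar>) \<in> O[at_right 0](\<lambda>\<epsilon>. 1 / \<epsilon> ^ N))" for K bs
  have *: "(\<forall>K. compact K \<longrightarrow> K \<noteq> {} \<longrightarrow> E K bs) \<longleftrightarrow> moderately_bounded (\<lambda>\<epsilon>. partial_deriv bs (u \<epsilon>))" (is "?L \<longleftrightarrow> ?R")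
    if sm: "\<forall>\<epsilon>\<in>index_set. smooth (u \<epsilon>)" and bs: "set bs \<subseteq> Basis" for bs
  proof -
    have "\<forall>\<^sub>F \<epsilon> in at_right 0. continuous_on K (partial_deriv bs (u \<epsilon>))" for K
      using eventually_index_set by eventually_elim (use sm bs smooth_continuous in blast)
    then have iff: "(\<lambda>\<epsilon>. SUP x\<in>K. \<bar>partial_deriv bs (u \<epsilon>) x\<bar>) \<in> O[at_right 0](h) \<longleftrightarrow>
        (\<exists>c. \<forall>\<^sub>F \<epsilon> in at_right 0. \<forall>x\<in>K. \<bar>partial_deriv bs (u \<epsilon>) x\<bar> \<le> c * \<bar>h \<epsilon>\<bar>)"
      if "compact K" "K \<noteq> {}" for K h using that by (intro bigo_SUP_iff)
    show ?thesis
    proof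
      assume L: ?L
      show ?R
      proof (rule moderately_boundedI_const)
        fix K :: "'a set" assume K: "compact K" "K \<noteq> {}"
        then obtain N c where
          "\<forall>\<^sub>F \<epsilon> in at_right 0. \<forall>x\<in>K. \<bar>partial_deriv bs (u \<epsilon>) x\<bar> \<le> c * \<bar>1 / \<epsilon> ^ N\<bar>"
          using L[rule_format, OF K] unfolding E_def iff[OF K] by blast
        then have "\<forall>\<^sub>F \<epsilon> in at_right 0. \<forall>x\<in>K. norm (partial_deriv bs (u \<epsilon>) x) \<le> c / \<epsilon> ^ N"
          using eventually_index_set by eventually_elim auto
        then show "\<exists>N c. \<forall>\<^sub>F \<epsilon> in at_right 0. \<forall>x\<in>K. norm (partial_deriv bs (u \<epsilon>) x) \<le> c / \<epsilon> ^ N"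
          by blast
      qed
    next
      assume R: ?R
      show ?L
      proof (intro allI impI)
        fix K :: "'a set" assume K: "compact K" "K \<noteq> {}"
        then obtain N :: nat where
          "\<forall>\<^sub>F \<epsilon> in at_right 0. \<forall>x\<in>K. norm (partial_deriv bs (u \<epsilon>) x) \<le> 1 / \<epsilon> ^ N"
          using R unfolding moderately_bounded_def by blast
        then have "\<forall>\<^sub>F \<epsilon> in at_right 0. \<forall>x\<in>K. \<bar>partial_deriv bs (u \<epsilon>) x\<bar> \<le> 1 * \<bar>1 / \<epsilon> ^ N\<bar>"
          using eventually_index_set by eventually_elim auto
        then show "E K bs"
          unfolding E_def iff[OF K] by blast
      qed
    qed
  qed
  show ?thesis unfolding moderate_def mem_Collect_eq E_def[symmetric]
    using * by (intro conj_cong refl) meson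
qed

lemma negligible_iff: "u \<in> negligible_nets \<longleftrightarrow> u \<in> moderate \<and> rapidly_small u"
proof -
  have "(\<forall>K. compact K \<longrightarrow> K \<noteq> {} \<longrightarrow>
     (\<forall>q::nat. (\<lambda>\<epsilon>. SUP x\<in>K. \<bar>u \<epsilon> x\<bar>) \<in> O[at_right 0](\<lambda>\<epsilon>. \<epsilon> ^ q))) \<longleftrightarrow> rapidly_small u"
    (is "?L \<longleftrightarrow> ?R") if u: "u \<in> moderate"
  proof -
    have "continuous_on K (u \<epsilon>)" if "\<epsilon> \<in> index_set" for K \<epsilon>
      using u that smooth_continuous[of "u \<epsilon>" "[]" K] unfolding moderate_iff by simp
    then have "\<forall>\<^sub>F \<epsilon> in at_right 0. continuous_on K (u \<epsilon>)" for K
      using eventually_index_set by (auto elim: eventually_mono)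
    then have iff: "(\<lambda>\<epsilon>. SUP x\<in>K. \<bar>u \<epsilon> x\<bar>) \<in> O[at_right 0](h) \<longleftrightarrow>
        (\<exists>c. \<forall>\<^sub>F \<epsilon> in at_right 0. \<forall>x\<in>K. \<bar>u \<epsilon> x\<bar> \<le> c * \<bar>h \<epsilon>\<bar>)"
      if "compact K" "K \<noteq> {}" for K h using that by (intro bigo_SUP_iff)
    show ?thesis
    proof
      assume L: ?L
      show ?R
      proof (rule rapidly_smallI_const)
        fix K :: "'a set" and q :: nat assume K: "compact K" "K \<noteq> {}"
        then obtain c where "\<forall>\<^sub>F \<epsilon> in at_right 0. \<forall>x\<in>K. \<bar>u \<epsilon> x\<bar> \<le> c * \<bar>\<epsilon> ^ q\<bar>"
          using L[rule_format, OF K] unfolding iff[OF K] by blast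
        then have "\<forall>\<^sub>F \<epsilon> in at_right 0. \<forall>x\<in>K. norm (u \<epsilon> x) \<le> c * \<epsilon> ^ q"
          using eventually_index_set by eventually_elim auto
        then show "\<exists>c. \<forall>\<^sub>F \<epsilon> in at_right 0. \<forall>x\<in>K. norm (u \<epsilon> x) \<le> c * \<epsilon> ^ q" by blast
      qed
    next
      assume R: ?R
      show ?L
      proof (intro allI impI)
        fix K :: "'a set" and q :: nat assume K: "compact K" "K \<noteq> {}"
        then have "\<forall>\<^sub>F \<epsilon> in at_right 0. \<forall>x\<in>K. norm (u \<epsilon> x) \<le> \<epsilon> ^ q"
          using R unfolding rapidly_small_def by blast
        then have "\<forall>\<^sub>F \<epsilon> in at_right 0. \<forall>x\<in>K. \<bar>u \<epsilon> x\<bar> \<le> 1 * \<bar>\<epsilon> ^ q\<bar>"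
          using eventually_index_set by eventually_elim auto
        then show "(\<lambda>\<epsilon>. SUP x\<in>K. \<bar>u \<epsilon> x\<bar>) \<in> O[at_right 0](\<lambda>\<epsilon>. \<epsilon> ^ q)"
          unfolding iff[OF K] by blast
      qed
    qed
  qed
  then show ?thesis unfolding negligible_nets_def mem_Collect_eq by (intro conj_cong refl)
qed

lemma moderately_bounded_cong:
  assumes "moderately_bounded u" "\<And>\<epsilon> x. \<epsilon> \<in> index_set \<Longrightarrow> v \<epsilon> x = u \<epsilon> x"
  shows "moderately_bounded v"
  unfolding moderately_bounded_def
proof (intro allI impI)
  fix K :: "'a set" assume "compact K"
  then obtain N :: nat where "\<forall>\<^sub>F \<epsilon> in at_right 0. \<forall>x\<in>K. norm (u \<epsilon> x) \<le> 1 / \<epsilon> ^ N"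
    using assms(1) unfolding moderately_bounded_def by blast
  then have "\<forall>\<^sub>F \<epsilon> in at_right 0. \<forall>x\<in>K. norm (v \<epsilon> x) \<le> 1 / \<epsilon> ^ N"
    using eventually_index_set by eventually_elim (simp add: assms(2))
  then show "\<exists>N::nat. \<forall>\<^sub>F \<epsilon> in at_right 0. \<forall>x\<in>K. norm (v \<epsilon> x) \<le> 1 / \<epsilon> ^ N" by blast
qed

lemma rapidly_small_cong:
  assumes "rapidly_small u" "\<forall>\<^sub>F \<epsilon> in at_right 0. \<forall>x. v \<epsilon> x = u \<epsilon> x"
  shows "rapidly_small v"
  unfolding rapidly_small_def
proof (intro allI impI)
  fix K :: "'a set" and q :: nat assume "compact K"
  then have "\<forall>\<^sub>F \<epsilon> in at_right 0. \<forall>x\<in>K. norm (u \<epsilon> x) \<le> \<epsilon> ^ q"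
    using assms(1) unfolding rapidly_small_def by blast
  then show "\<forall>\<^sub>F \<epsilon> in at_right 0. \<forall>x\<in>K. norm (v \<epsilon> x) \<le> \<epsilon> ^ q"
    using assms(2) by eventually_elim simp
qed

section \<open>Derivatives and differences of nets\<close>

lemma partial_deriv_differentiable:
  assumes "smooth f" "set bs \<subseteq> Basis"
  shows "partial_deriv bs f differentiable (at x)"
  using assms unfolding smooth_def differentiable_on_def by auto

lemma smooth_differentiable: "smooth f \<Longrightarrow> f differentiable (at x)"
  using partial_deriv_differentiable[of f "[]"] by simp

lemma partial_deriv_append: "partial_deriv (bs @ cs) f = partial_deriv bs (partial_deriv cs f)"
  by (induction bs) simp_all

lemma moderate_cong:
  assumes "u \<in> moderate" "\<And>\<epsilon> x. \<epsilon> \<in> index_set \<Longrightarrow> v \<epsilon> x = u \<epsilon> x"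
  shows "v \<in> moderate"
proof -
  have eq: "v \<epsilon> = u \<epsilon>" if "\<epsilon> \<in> index_set" for \<epsilon> using assms(2)[OF that] by blast
  have "moderately_bounded (\<lambda>\<epsilon>. partial_deriv bs (v \<epsilon>))" if "set bs \<subseteq> Basis" for bs
  proof (rule moderately_bounded_cong)
    show "moderately_bounded (\<lambda>\<epsilon>. partial_deriv bs (u \<epsilon>))"
      using assms(1) that unfolding moderate_iff by blast
  qed (simp only: eq)
  moreover have "smooth (v \<epsilon>)" if "\<epsilon> \<in> index_set" for \<epsilon>
    using assms(1) that unfolding moderate_iff eq[OF that] by blast
  ultimately show ?thesis unfolding moderate_iff by blast
qed

lemma moderate_partial_deriv:
  assumes "u \<in> moderate" "set cs \<subseteq> Basis"
  shows "(\<lambda>\<epsilon>. partial_deriv cs (u \<epsilon>)) \<in> moderate"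
  unfolding moderate_iff
proof (intro conjI ballI allI impI)
  fix \<epsilon> :: real assume "\<epsilon> \<in> index_set"
  then have "smooth (u \<epsilon>)" using assms(1) by (simp add: moderate_iff)
  then show "smooth (partial_deriv cs (u \<epsilon>))"
    using assms(2) unfolding smooth_def partial_deriv_append[symmetric] by simp
next
  fix bs :: "'a list" assume "set bs \<subseteq> Basis"
  then show "moderately_bounded (\<lambda>\<epsilon>. partial_deriv bs (partial_deriv cs (u \<epsilon>)))"
    using assms unfolding partial_deriv_append[symmetric] moderate_iff by simp
qed

text \<open>Where a function is not differentiable, \<open>frechet_derivative\<close> is an
  arbitrary choice, so linearity has to rest on smoothness of both functions.\<close>

lemma partial_deriv_diff:
  assumes "smooth f" "smooth g" "set bs \<subseteq> Basis"
  shows "partial_deriv bs (\<lambda>x. f x - g x) = (\<lambda>x. partial_deriv bs f x - partial_deriv bs g x)"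
  using assms(3)
proof (induction bs)
  case (Cons b bs)
  have "((\<lambda>x. partial_deriv bs f x - partial_deriv bs g x) has_derivative
      (\<lambda>h. frechet_derivative (partial_deriv bs f) (at x) h -
           frechet_derivative (partial_deriv bs g) (at x) h)) (at x)" for x
    using Cons.prems assms
    by (intro has_derivative_diff; simp add: frechet_derivative_works[symmetric] partial_deriv_differentiable)
  from frechet_derivative_at[OF this, symmetric] show ?case using Cons by simp
qed simp

lemma smooth_diff: "smooth f \<Longrightarrow> smooth g \<Longrightarrow> smooth (\<lambda>x. f x - g x)"
  by (subst smooth_def) (auto simp: partial_deriv_diff smooth_def intro!: differentiable_on_diff)

lemma moderately_bounded_diff:
  assumes "moderately_bounded u" "moderately_bounded v"
  shows "moderately_bounded (\<lambda>\<epsilon> x. u \<epsilon> x - v \<epsilon> x)"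
proof (rule moderately_boundedI_const)
  fix K :: "'a set" assume "compact K"
  then obtain N M :: nat
    where "\<forall>\<^sub>F \<epsilon> in at_right 0. \<forall>x\<in>K. norm (u \<epsilon> x) \<le> 1 / \<epsilon> ^ N"
      "\<forall>\<^sub>F \<epsilon> in at_right 0. \<forall>x\<in>K. norm (v \<epsilon> x) \<le> 1 / \<epsilon> ^ M"
    using assms unfolding moderately_bounded_def by meson
  \<comment> \<open>On (0, 1] both bounds are at most the one with exponent \<open>N+M\<close>, so a
    single exponent serves.\<close>
  moreover have "\<forall>\<^sub>F \<epsilon> in at_right (0::real). 1 / \<epsilon> ^ N \<le> 1 / \<epsilon> ^ (N+M) \<and> 1 / \<epsilon> ^ M \<le> 1 / \<epsilon> ^ (N+M)"
    using eventually_power_antimono[OF le_add1[of N M]] eventually_power_antimono[OF le_add2[of M N]]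
    by eventually_elim auto
  ultimately have "\<forall>\<^sub>F \<epsilon> in at_right 0. \<forall>x\<in>K. norm (u \<epsilon> x - v \<epsilon> x) \<le> 2 / \<epsilon> ^ (N+M)"
  proof eventually_elim
    case (elim \<epsilon>)
    show ?case
    proof
      fix x assume "x \<in> K"
      then show "norm (u \<epsilon> x - v \<epsilon> x) \<le> 2 / \<epsilon> ^ (N+M)"
        using elim norm_triangle_ineq4[of "u \<epsilon> x" "v \<epsilon> x"] by fastforce
    qed
  qed
  then show "\<exists>N c. \<forall>\<^sub>F \<epsilon> in at_right 0. \<forall>x\<in>K. norm (u \<epsilon> x - v \<epsilon> x) \<le> c / \<epsilon> ^ N" by blast
qed

lemma rapidly_small_diff:
  assumes "rapidly_small u" "rapidly_small v"
  shows "rapidly_small (\<lambda>\<epsilon> x. u \<epsilon> x - v \<epsilon> x)"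
proof (rule rapidly_smallI_const)
  fix K :: "'a set" and q :: nat assume "compact K"
  then have "\<forall>\<^sub>F \<epsilon> in at_right 0. \<forall>x\<in>K. norm (u \<epsilon> x) \<le> \<epsilon> ^ q"
    "\<forall>\<^sub>F \<epsilon> in at_right 0. \<forall>x\<in>K. norm (v \<epsilon> x) \<le> \<epsilon> ^ q"
    using assms unfolding rapidly_small_def by blast+
  then have "\<forall>\<^sub>F \<epsilon> in at_right 0. \<forall>x\<in>K. norm (u \<epsilon> x - v \<epsilon> x) \<le> 2 * \<epsilon> ^ q"
    by eventually_elim (smt (verit) norm_triangle_ineq4)
  then show "\<exists>c. \<forall>\<^sub>F \<epsilon> in at_right 0. \<forall>x\<in>K. norm (u \<epsilon> x - v \<epsilon> x) \<le> c * \<epsilon> ^ q" by blast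
qed

lemma moderate_diff:
  assumes "u \<in> moderate" "v \<in> moderate"
  shows "(\<lambda>\<epsilon> x. u \<epsilon> x - v \<epsilon> x) \<in> moderate"
proof -
  have "moderately_bounded (\<lambda>\<epsilon>. partial_deriv bs (\<lambda>x. u \<epsilon> x - v \<epsilon> x))" if "set bs \<subseteq> Basis" for bs
  proof (rule moderately_bounded_cong)
    show "moderately_bounded (\<lambda>\<epsilon> x. partial_deriv bs (u \<epsilon>) x - partial_deriv bs (v \<epsilon>) x)"
      using assms that unfolding moderate_iff by (intro moderately_bounded_diff) blast+
  next
    fix \<epsilon> :: real and x assume "\<epsilon> \<in> index_set"
    then have "smooth (u \<epsilon>)" "smooth (v \<epsilon>)" using assms unfolding moderate_iff by blast+
    from partial_deriv_diff[OF this that]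
    show "partial_deriv bs (\<lambda>x. u \<epsilon> x - v \<epsilon> x) x = partial_deriv bs (u \<epsilon>) x - partial_deriv bs (v \<epsilon>) x"
      by simp
  qed
  then show ?thesis using assms unfolding moderate_iff by (blast intro: smooth_diff)
qed

section \<open>The equivalence relations behind the quotients\<close>

lemma colombeau_rel_iff:
  "(u, v) \<in> colombeau_rel \<longleftrightarrow>
    u \<in> moderate \<and> v \<in> moderate \<and> rapidly_small (\<lambda>\<epsilon> x. u \<epsilon> x - v \<epsilon> x)"
  unfolding colombeau_rel_def by (auto simp: negligible_iff moderate_diff)

lemma rapidly_small_0: "rapidly_small (\<lambda>\<epsilon> x. 0)"
  unfolding rapidly_small_def
  by (intro allI impI eventually_mono[OF eventually_index_set]) auto

lemma rapidly_small_swap: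
  "rapidly_small (\<lambda>\<epsilon> x. u \<epsilon> x - v \<epsilon> x) \<Longrightarrow> rapidly_small (\<lambda>\<epsilon> x. v \<epsilon> x - u \<epsilon> x)"
  unfolding rapidly_small_def by (simp add: norm_minus_commute)

lemma rapidly_small_trans:
  "rapidly_small (\<lambda>\<epsilon> x. u \<epsilon> x - v \<epsilon> x) \<Longrightarrow> rapidly_small (\<lambda>\<epsilon> x. v \<epsilon> x - w \<epsilon> x) \<Longrightarrow>
    rapidly_small (\<lambda>\<epsilon> x. u \<epsilon> x - w \<epsilon> x)"
  by (drule rapidly_small_swap[of v w], drule (1) rapidly_small_diff) simp

lemma equiv_colombeau_rel: "equiv moderate colombeau_rel"
proof (rule equivI)
  show "colombeau_rel \<subseteq> moderate \<times> moderate" by (auto simp: colombeau_rel_iff)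
  show "refl_on moderate colombeau_rel"
    by (auto simp: refl_on_def colombeau_rel_iff rapidly_small_0)
  show "sym colombeau_rel"
    by (auto simp: sym_def colombeau_rel_iff intro: rapidly_small_swap)
  show "trans colombeau_rel"
    by (auto simp: trans_def colombeau_rel_iff intro: rapidly_small_trans)
qed

text \<open>There are finitely many coordinates, so their eventual bounds can be combined; passing
  through the 1-norm costs the dimension as a constant.\<close>

lemma rapidly_small_component:
  fixes u :: "('a::euclidean_space, real ^ 'n) net"
  shows "rapidly_small u \<longleftrightarrow> (\<forall>i. rapidly_small (component i u))"
proof
  assume u: "rapidly_small u"
  show "\<forall>i. rapidly_small (component i u)"
    unfolding rapidly_small_def
  proof (intro allI impI)
    fix i and K :: "'a set" and q :: nat assume "compact K"
    then have "\<forall>\<^sub>F \<epsilon> in at_right 0. \<forall>x\<in>K. norm (u \<epsilon> x) \<le> \<epsilon> ^ q"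
      using u unfolding rapidly_small_def by blast
    then show "\<forall>\<^sub>F \<epsilon> in at_right 0. \<forall>x\<in>K. norm (component i u \<epsilon> x) \<le> \<epsilon> ^ q"
      by eventually_elim (auto simp: component_def intro: order.trans[OF component_le_norm_cart])
  qed
next
  assume u: "\<forall>i. rapidly_small (component i u)"
  show "rapidly_small u"
  proof (rule rapidly_smallI_const)
    fix K :: "'a set" and q :: nat assume "compact K"
    then have "\<forall>\<^sub>F \<epsilon> in at_right 0. \<forall>i. \<forall>x\<in>K. norm (component i u \<epsilon> x) \<le> \<epsilon> ^ q"
      using u unfolding rapidly_small_def by (intro eventually_all_finite) blast
    then have "\<forall>\<^sub>F \<epsilon> in at_right 0. \<forall>x\<in>K. norm (u \<epsilon> x) \<le> real CARD('n) * \<epsilon> ^ q"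
    proof eventually_elim
      case (elim \<epsilon>)
      show ?case
      proof
        fix x assume "x \<in> K"
        have "norm (u \<epsilon> x) \<le> (\<Sum>i\<in>UNIV. \<bar>u \<epsilon> x $ i\<bar>)" by (rule norm_le_l1_cart)
        also have "\<dots> \<le> (\<Sum>i\<in>(UNIV::'n set). \<epsilon> ^ q)"
          using elim \<open>x \<in> K\<close> by (intro sum_mono) (auto simp: component_def)
        finally show "norm (u \<epsilon> x) \<le> real CARD('n) * \<epsilon> ^ q" by simp
      qed
    qed
    then show "\<exists>c. \<forall>\<^sub>F \<epsilon> in at_right 0. \<forall>x\<in>K. norm (u \<epsilon> x) \<le> c * \<epsilon> ^ q" by blast
  qed
qed

text \<open>The difference of two moderate nets is automatically moderate, so equality of classes is
  a pure order-zero estimate. This is the form in which uniqueness is proved.\<close>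

lemma c_bounded_rel_iff:
  "(u, v) \<in> c_bounded_rel \<longleftrightarrow>
    u \<in> c_bounded_nets \<and> v \<in> c_bounded_nets \<and> rapidly_small (\<lambda>\<epsilon> x. u \<epsilon> x - v \<epsilon> x)"
proof -
  have eq: "component i (\<lambda>\<epsilon> x. u \<epsilon> x - v \<epsilon> x) = (\<lambda>\<epsilon> x. component i u \<epsilon> x - component i v \<epsilon> x)" for i
    by (simp add: component_def)
  show ?thesis
    unfolding c_bounded_rel_def rapidly_small_component
    by (auto simp: negligible_iff eq c_bounded_nets_def moderate_diff)
qed

lemma equiv_c_bounded_rel: "equiv c_bounded_nets c_bounded_rel"
proof (rule equivI)
  show "c_bounded_rel \<subseteq> c_bounded_nets \<times> c_bounded_nets" by (auto simp: c_bounded_rel_iff)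
  show "refl_on c_bounded_nets c_bounded_rel"
    by (auto simp: refl_on_def c_bounded_rel_iff rapidly_small_0)
  show "sym c_bounded_rel"
    by (auto simp: sym_def c_bounded_rel_iff intro: rapidly_small_swap)
  show "trans c_bounded_rel"
    by (auto simp: trans_def c_bounded_rel_iff intro: rapidly_small_trans)
qed

lemma equiv_point_rel: "equiv compact_nets point_rel"
proof (rule equivI)
  show "point_rel \<subseteq> compact_nets \<times> compact_nets" by (auto simp: point_rel_def)
  show "refl_on compact_nets point_rel"
    by (auto simp: refl_on_def point_rel_def)
  show "sym point_rel"
    by (auto simp: sym_def point_rel_def norm_minus_commute)
  show "trans point_rel"
  proof (rule transI)
    fix x y z :: "real \<Rightarrow> real ^ 'n" assume xy: "(x, y) \<in> point_rel" "(y, z) \<in> point_rel"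
    have "(\<lambda>\<epsilon>. norm (x \<epsilon> - z \<epsilon>)) \<in> O[at_right 0](\<lambda>\<epsilon>. \<epsilon> powr m)" if "m > 0" for m
    proof -
      have "(\<lambda>\<epsilon>. norm (x \<epsilon> - y \<epsilon>) + norm (y \<epsilon> - z \<epsilon>)) \<in> O[at_right 0](\<lambda>\<epsilon>. \<epsilon> powr m)"
        using xy that by (intro sum_in_bigo) (auto simp: point_rel_def)
      moreover have "norm (x \<epsilon> - z \<epsilon>) \<le> norm (x \<epsilon> - y \<epsilon>) + norm (y \<epsilon> - z \<epsilon>)" for \<epsilon>
        using norm_triangle_ineq[of "x \<epsilon> - y \<epsilon>" "y \<epsilon> - z \<epsilon>"] by simp
      then have "(\<lambda>\<epsilon>. norm (x \<epsilon> - z \<epsilon>)) \<in> O[at_right 0](\<lambda>\<epsilon>. norm (x \<epsilon> - y \<epsilon>) + norm (y \<epsilon> - z \<epsilon>))"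
        by (intro bigoI[of _ 1]) (simp add: abs_of_nonneg add_nonneg_nonneg)
      ultimately show ?thesis by (rule landau_o.big_trans[rotated])
    qed
    then show "(x, z) \<in> point_rel" using xy by (auto simp: point_rel_def)
  qed
qed

section \<open>Moderate nets of one real variable\<close>

text \<open>Derivatives of order up to \<open>k\<close> with moderate bounds, given by witnesses
  instead of \<open>partial_deriv\<close>. Sum, product and chain rules then go through by induction
  on \<open>k\<close>, each step naming the next derivative explicitly.\<close>

primrec moderate_upto :: "nat \<Rightarrow> (real, real) net \<Rightarrow> bool" where
  "moderate_upto 0 u \<longleftrightarrow> (\<forall>\<epsilon>\<in>index_set. continuous_on UNIV (u \<epsilon>)) \<and> moderately_bounded u"
| "moderate_upto (Suc k) u \<longleftrightarrow> moderately_bounded u \<and>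
     (\<exists>v. (\<forall>\<epsilon>\<in>index_set. \<forall>t. (u \<epsilon> has_real_derivative v \<epsilon> t) (at t)) \<and> moderate_upto k v)"

lemma moderate_upto_bounded: "moderate_upto k u \<Longrightarrow> moderately_bounded u"
  by (cases k) auto

lemma moderate_upto_mono: "moderate_upto (Suc k) u \<Longrightarrow> moderate_upto k u"
proof (induction k arbitrary: u)
  case 0
  then show ?case by (auto intro!: continuous_at_imp_continuous_on dest!: DERIV_isCont)
next
  case (Suc k)
  from Suc.prems obtain v where v: "moderately_bounded u"
    "\<forall>\<epsilon>\<in>index_set. \<forall>t. (u \<epsilon> has_real_derivative v \<epsilon> t) (at t)" "moderate_upto (Suc k) v"
    unfolding moderate_upto.simps(2)[of "Suc k"] by blast
  from v(1,2) Suc.IH[OF v(3)] show ?case by auto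
qed

lemma partial_deriv_1:
  assumes "(u has_real_derivative d) (at t)"
  shows "partial_deriv [1] u t = d"
  using frechet_derivative_at[OF assms[unfolded has_field_derivative_def], symmetric] by simp

text \<open>The shift from \<open>Suc k\<close> to \<open>k\<close> is the price of smoothness: the
  derivative of order \<open>k\<close> has itself to be differentiable.\<close>

lemma moderate_upto_imp:
  assumes "moderate_upto (Suc k) u"
  shows "(\<forall>\<epsilon>\<in>index_set. partial_deriv (replicate k 1) (u \<epsilon>) differentiable_on UNIV) \<and>
    moderately_bounded (\<lambda>\<epsilon>. partial_deriv (replicate k 1) (u \<epsilon>))"
  using assms
proof (induction k arbitrary: u)
  case 0
  then show ?case
    by (auto simp: differentiable_on_def real_differentiable_def)
next
  case (Suc k)
  from Suc.prems obtain v where v: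
    "\<forall>\<epsilon>\<in>index_set. \<forall>t. (u \<epsilon> has_real_derivative v \<epsilon> t) (at t)" "moderate_upto (Suc k) v"
    unfolding moderate_upto.simps(2)[of "Suc k"] by blast
  have rep: "partial_deriv (replicate (Suc k) 1) (u \<epsilon>) = partial_deriv (replicate k 1) (v \<epsilon>)"
    if "\<epsilon> \<in> index_set" for \<epsilon>
  proof -
    have "partial_deriv [1] (u \<epsilon>) = v \<epsilon>" using v(1) that by (intro ext partial_deriv_1) blast
    \<comment> \<open>\<open>partial_deriv\<close> takes the head of the list as the outermost
      derivative, whereas \<open>v\<close> is the innermost one, so one entry is moved to the
      end.\<close>
    moreover have "replicate (Suc k) (1::real) = replicate k 1 @ [1]"
      by (simp add: replicate_append_same)
    ultimately show ?thesis by (simp only: partial_deriv_append)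
  qed
  have "moderately_bounded (\<lambda>\<epsilon>. partial_deriv (replicate (Suc k) 1) (u \<epsilon>))"
    by (rule moderately_bounded_cong[OF conjunct2[OF Suc.IH[OF v(2)]]]) (simp only: rep)
  moreover have "\<forall>\<epsilon>\<in>index_set. partial_deriv (replicate (Suc k) 1) (u \<epsilon>) differentiable_on UNIV"
    by (intro ballI, subst rep) (use Suc.IH[OF v(2)] in blast)+
  ultimately show ?case by blast
qed

lemma moderate_has_derivative:
  fixes u :: "(real, real) net"
  assumes "u \<in> moderate" "\<epsilon> \<in> index_set"
  shows "(u \<epsilon> has_real_derivative partial_deriv [1] (u \<epsilon>) t) (at t)"
proof -
  have "u \<epsilon> differentiable (at t)" using assms unfolding moderate_iff by (blast intro: smooth_differentiable)
  then obtain d where "(u \<epsilon> has_real_derivative d) (at t)" using real_differentiableE by blast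
  then show ?thesis using partial_deriv_1 by metis
qed

lemma moderate_imp_moderate_upto:
  assumes "u \<in> moderate"
  shows "moderate_upto k u"
  using assms
proof (induction k arbitrary: u)
  case 0
  then show ?case
    using smooth_continuous[of _ "[]"] by (auto simp: moderate_iff dest: spec[of _ "[]"])
next
  case (Suc k)
  have "moderately_bounded u" using Suc.prems by (auto simp: moderate_iff dest: spec[of _ "[]"])
  moreover have "moderate_upto k (\<lambda>\<epsilon>. partial_deriv [1] (u \<epsilon>))"
    using Suc.prems by (intro Suc.IH moderate_partial_deriv) auto
  moreover have "\<forall>\<epsilon>\<in>index_set. \<forall>t. (u \<epsilon> has_real_derivative partial_deriv [1] (u \<epsilon>) t) (at t)"
    using moderate_has_derivative[OF Suc.prems] by blast
  ultimately show ?case unfolding moderate_upto.simps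
    by (intro conjI exI[of _ "\<lambda>\<epsilon>. partial_deriv [1] (u \<epsilon>)"])
qed

lemma moderate_iff_moderate_upto: "u \<in> moderate \<longleftrightarrow> (\<forall>k. moderate_upto k u)"
proof
  assume *: "\<forall>k. moderate_upto k u"
  \<comment> \<open>The only basis vector of the reals is 1, so a multi-index is determined by its
    order.\<close>
  have bs: "bs = replicate (length bs) 1" if "set bs \<subseteq> Basis" for bs :: "real list"
    using that by (induction bs) auto
  have "(\<forall>\<epsilon>\<in>index_set. partial_deriv bs (u \<epsilon>) differentiable_on UNIV) \<and>
      moderately_bounded (\<lambda>\<epsilon>. partial_deriv bs (u \<epsilon>))" if "set bs \<subseteq> Basis" for bs
    by (subst (1 2) bs[OF that], rule moderate_upto_imp) (use * in blast)
  then show "u \<in> moderate"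
    unfolding moderate_iff smooth_def by blast
qed (simp add: moderate_imp_moderate_upto)

lemma moderately_bounded_add:
  assumes "moderately_bounded u" "moderately_bounded v"
  shows "moderately_bounded (\<lambda>\<epsilon> x. u \<epsilon> x + v \<epsilon> x)"
proof -
  have "moderately_bounded (\<lambda>\<epsilon> x. - v \<epsilon> x)"
    using assms(2) by (simp add: moderately_bounded_def)
  from moderately_bounded_diff[OF assms(1) this] show ?thesis by simp
qed

lemma moderately_bounded_mult:
  fixes u v :: "('a::euclidean_space, real) net"
  assumes "moderately_bounded u" "moderately_bounded v"
  shows "moderately_bounded (\<lambda>\<epsilon> x. u \<epsilon> x * v \<epsilon> x)"
  unfolding moderately_bounded_def
proof (intro allI impI)
  fix K :: "'a set" assume "compact K"
  then obtain N M :: nat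
    where "\<forall>\<^sub>F \<epsilon> in at_right 0. \<forall>x\<in>K. norm (u \<epsilon> x) \<le> 1 / \<epsilon> ^ N"
      "\<forall>\<^sub>F \<epsilon> in at_right 0. \<forall>x\<in>K. norm (v \<epsilon> x) \<le> 1 / \<epsilon> ^ M"
    using assms unfolding moderately_bounded_def by meson
  then have "\<forall>\<^sub>F \<epsilon> in at_right 0. \<forall>x\<in>K. norm (u \<epsilon> x * v \<epsilon> x) \<le> 1 / \<epsilon> ^ (N+M)"
    using eventually_index_set
  proof eventually_elim
    case (elim \<epsilon>)
    show ?case
    proof
      fix x assume "x \<in> K"
      then have "norm (u \<epsilon> x) * norm (v \<epsilon> x) \<le> (1 / \<epsilon> ^ N) * (1 / \<epsilon> ^ M)"
        using elim by (intro mult_mono) auto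
      then show "norm (u \<epsilon> x * v \<epsilon> x) \<le> 1 / \<epsilon> ^ (N+M)" by (simp add: abs_mult power_add)
    qed
  qed
  then show "\<exists>N::nat. \<forall>\<^sub>F \<epsilon> in at_right 0. \<forall>x\<in>K. norm (u \<epsilon> x * v \<epsilon> x) \<le> 1 / \<epsilon> ^ N" by blast
qed

lemma moderate_upto_add:
  "moderate_upto k u \<Longrightarrow> moderate_upto k v \<Longrightarrow> moderate_upto k (\<lambda>\<epsilon> t. u \<epsilon> t + v \<epsilon> t)"
proof (induction k arbitrary: u v)
  case 0
  then show ?case by (auto intro: continuous_on_add moderately_bounded_add)
next
  case (Suc k)
  from Suc.prems obtain u' v' where d: "moderately_bounded u" "moderately_bounded v"
    "\<forall>\<epsilon>\<in>index_set. \<forall>t. (u \<epsilon> has_real_derivative u' \<epsilon> t) (at t)" "moderate_upto k u'"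
    "\<forall>\<epsilon>\<in>index_set. \<forall>t. (v \<epsilon> has_real_derivative v' \<epsilon> t) (at t)" "moderate_upto k v'"
    by auto
  have "\<forall>\<epsilon>\<in>index_set. \<forall>t. ((\<lambda>t. u \<epsilon> t + v \<epsilon> t) has_real_derivative u' \<epsilon> t + v' \<epsilon> t) (at t)"
    using d by (auto intro: DERIV_add)
  with Suc.IH[OF d(4,6)] moderately_bounded_add[OF d(1,2)] show ?case
    unfolding moderate_upto.simps
    by (intro conjI exI[of _ "\<lambda>\<epsilon> t. u' \<epsilon> t + v' \<epsilon> t"])
qed

lemma moderate_upto_mult:
  "moderate_upto k u \<Longrightarrow> moderate_upto k v \<Longrightarrow> moderate_upto k (\<lambda>\<epsilon> t. u \<epsilon> t * v \<epsilon> t)"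
proof (induction k arbitrary: u v)
  case 0
  then show ?case by (auto intro: continuous_on_mult moderately_bounded_mult)
next
  case (Suc k)
  from Suc.prems obtain u' v' where d: "moderately_bounded u" "moderately_bounded v"
    "\<forall>\<epsilon>\<in>index_set. \<forall>t. (u \<epsilon> has_real_derivative u' \<epsilon> t) (at t)" "moderate_upto k u'"
    "\<forall>\<epsilon>\<in>index_set. \<forall>t. (v \<epsilon> has_real_derivative v' \<epsilon> t) (at t)" "moderate_upto k v'"
    by auto
  have "\<forall>\<epsilon>\<in>index_set. \<forall>t. ((\<lambda>t. u \<epsilon> t * v \<epsilon> t) has_real_derivative
      u' \<epsilon> t * v \<epsilon> t + v' \<epsilon> t * u \<epsilon> t) (at t)"
    using d by (auto intro: DERIV_mult)
  \<comment> \<open>The product rule pairs a derivative with an undifferentiated factor, so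
    \<open>u\<close> and \<open>v\<close> are lowered to order \<open>k\<close> as well.\<close>
  moreover have "moderate_upto k (\<lambda>\<epsilon> t. u' \<epsilon> t * v \<epsilon> t + v' \<epsilon> t * u \<epsilon> t)"
    using Suc.prems[THEN moderate_upto_mono] d by (intro moderate_upto_add Suc.IH)
  ultimately show ?case using moderately_bounded_mult[OF d(1,2)]
    unfolding moderate_upto.simps
    by (intro conjI exI[of _ "\<lambda>\<epsilon> t. u' \<epsilon> t * v \<epsilon> t + v' \<epsilon> t * u \<epsilon> t"])
qed

lemma moderate_upto_0: "moderate_upto k (\<lambda>\<epsilon> t. 0)"
proof (induction k)
  case 0
  have "\<forall>\<^sub>F \<epsilon> in at_right 0. \<forall>x\<in>K. norm (0::real) \<le> 1 / \<epsilon> ^ 0" for K :: "real set"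
    by simp
  then show ?case unfolding moderate_upto.simps moderately_bounded_def
    by (blast intro: continuous_on_const)
next
  case (Suc k)
  have "moderately_bounded (\<lambda>\<epsilon> t::real. 0::real)"
    using Suc by (rule moderate_upto_bounded)
  then show ?case using Suc by (auto intro!: exI[of _ "\<lambda>\<epsilon> t. 0"])
qed

lemma moderate_upto_sum:
  assumes "\<And>i. i \<in> A \<Longrightarrow> moderate_upto k (u i)"
  shows "moderate_upto k (\<lambda>\<epsilon> t. \<Sum>i\<in>A. u i \<epsilon> t)"
  using assms
  by (induction A rule: infinite_finite_induct) (simp_all add: moderate_upto_0 moderate_upto_add)

section \<open>Composition with c-bounded nets\<close>

lemma c_boundedD:
  assumes "c_bounded x" "compact K"
  obtains K' where "compact K'" "\<forall>\<^sub>F \<epsilon> in at_right 0. x \<epsilon> ` K \<subseteq> K'"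
proof -
  obtain \<epsilon>\<^sub>0 K' where K': "\<epsilon>\<^sub>0 > 0" "compact K'" "\<forall>\<epsilon>\<in>index_set. \<epsilon> < \<epsilon>\<^sub>0 \<longrightarrow> x \<epsilon> ` K \<subseteq> K'"
    using assms unfolding c_bounded_def by blast
  have "\<forall>\<^sub>F \<epsilon> in at_right 0. x \<epsilon> ` K \<subseteq> K'"
    using eventually_index_set eventually_at_right_0_less[OF K'(1)]
    by eventually_elim (use K'(3) in blast)
  with K'(2) that show thesis by blast
qed

lemma c_boundedI:
  assumes "\<And>K. compact K \<Longrightarrow> \<exists>K'. compact K' \<and> (\<forall>\<^sub>F \<epsilon> in at_right 0. x \<epsilon> ` K \<subseteq> K')"
  shows "c_bounded x"
  unfolding c_bounded_def
proof (intro allI impI)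
  fix K :: "'a set" assume "compact K"
  then obtain K' where "compact K'" "\<forall>\<^sub>F \<epsilon> in at_right 0. x \<epsilon> ` K \<subseteq> K'" using assms by blast
  then show "\<exists>\<epsilon>\<^sub>0>0. \<exists>K'. compact K' \<and> (\<forall>\<epsilon>\<in>index_set. \<epsilon> < \<epsilon>\<^sub>0 \<longrightarrow> x \<epsilon> ` K \<subseteq> K')"
    unfolding eventually_at_right_field by (metis greaterThanAtMost_iff)
qed

text \<open>The bound of \<open>f\<close> is uniform on compact sets only; c-boundedness places all
  values of \<open>x\<close> on \<open>K\<close> in a single compact set for small
  \<epsilon>.\<close>

lemma moderately_bounded_compose:
  fixes f :: "(real ^ 'n, 'b::real_normed_vector) net"
    and x :: "('a::euclidean_space, real ^ 'n) net"
  assumes "moderately_bounded f" "c_bounded x"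
  shows "moderately_bounded (\<lambda>\<epsilon> t. f \<epsilon> (x \<epsilon> t))"
  unfolding moderately_bounded_def
proof (intro allI impI)
  fix K :: "'a set" assume "compact K"
  then obtain K' where K': "compact K'" "\<forall>\<^sub>F \<epsilon> in at_right 0. x \<epsilon> ` K \<subseteq> K'"
    using c_boundedD[OF assms(2)] by metis
  obtain N :: nat where "\<forall>\<^sub>F \<epsilon> in at_right 0. \<forall>x\<in>K'. norm (f \<epsilon> x) \<le> 1 / \<epsilon> ^ N"
    using assms(1) K'(1) unfolding moderately_bounded_def by blast
  with K'(2) have "\<forall>\<^sub>F \<epsilon> in at_right 0. \<forall>t\<in>K. norm (f \<epsilon> (x \<epsilon> t)) \<le> 1 / \<epsilon> ^ N"
    by eventually_elim blast
  then show "\<exists>N::nat. \<forall>\<^sub>F \<epsilon> in at_right 0. \<forall>t\<in>K. norm (f \<epsilon> (x \<epsilon> t)) \<le> 1 / \<epsilon> ^ N" by blast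
qed

lemma smooth_derivative_eq:
  fixes f :: "real ^ 'n \<Rightarrow> real"
  assumes "smooth f"
  shows "(f has_derivative (\<lambda>h. \<Sum>i\<in>UNIV. h $ i * partial_deriv [axis i 1] f x)) (at x)"
proof -
  let ?D = "frechet_derivative f (at x)"
  have D: "(f has_derivative ?D) (at x)"
    using smooth_differentiable[OF assms] frechet_derivative_works by blast
  then interpret D: bounded_linear ?D by (rule has_derivative_bounded_linear)
  have "?D h = (\<Sum>i\<in>UNIV. h $ i * partial_deriv [axis i 1] f x)" for h
  proof -
    have "?D h = ?D (\<Sum>i\<in>UNIV. h $ i *\<^sub>R axis i 1)"
      using basis_expansion[of h] by (simp add: scalar_mult_eq_scaleR)
    then show ?thesis by (simp add: D.sum D.scaleR)
  qed
  then have "?D = (\<lambda>h. \<Sum>i\<in>UNIV. h $ i * partial_deriv [axis i 1] f x)" by blast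
  with D show ?thesis by (rule has_derivative_eq_rhs)
qed

lemma has_vector_derivative_vec_iff:
  fixes x :: "real \<Rightarrow> real ^ 'n"
  shows "(x has_vector_derivative v) (at t) \<longleftrightarrow>
    (\<forall>i. ((\<lambda>t. x t $ i) has_real_derivative v $ i) (at t))"
proof -
  have "(x has_vector_derivative v) (at t) \<longleftrightarrow>
      (\<forall>b\<in>range (\<lambda>i. axis i (1::real)). ((\<lambda>t. x t \<bullet> b) has_derivative (\<lambda>h. (h *\<^sub>R v) \<bullet> b)) (at t))"
    unfolding has_vector_derivative_def has_derivative_componentwise_within[of x]
    by (simp add: Basis_vec_def UNION_singleton_eq_range)
  then show ?thesis
    by (simp add: inner_axis has_field_derivative_def mult_commute_abs)
qed

lemma has_real_derivative_compose_vec: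
  fixes f :: "real ^ 'n \<Rightarrow> real"
  assumes "smooth f" "\<And>i. ((\<lambda>t. x t $ i) has_real_derivative v $ i) (at t)"
  shows "((\<lambda>t. f (x t)) has_real_derivative
    (\<Sum>i\<in>UNIV. v $ i * partial_deriv [axis i 1] f (x t))) (at t)"
proof -
  have "(x has_derivative (\<lambda>h. h *\<^sub>R v)) (at t)"
    using assms(2) by (simp add: has_vector_derivative_vec_iff flip: has_vector_derivative_def)
  from has_derivative_compose[OF this smooth_derivative_eq[OF assms(1)]]
  show ?thesis
    unfolding has_field_derivative_def
    by (rule has_derivative_eq_rhs) (simp add: fun_eq_iff sum_distrib_left sum_distrib_right mult_ac)
qed

text \<open>The chain rule replaces \<open>f\<close> by its first partial derivatives and keeps
  \<open>x\<close>, so induction with \<open>f\<close> arbitrary avoids any formula for higher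
  derivatives of a composition.\<close>

lemma moderate_upto_compose:
  fixes f :: "(real ^ 'n, real) net"
  assumes "f \<in> moderate" "c_bounded x" "\<And>i. moderate_upto k (component i x)"
  shows "moderate_upto k (\<lambda>\<epsilon>. f \<epsilon> \<circ> x \<epsilon>)"
  using assms(1,3)
proof (induction k arbitrary: f)
  case 0
  have "continuous_on UNIV (f \<epsilon> \<circ> x \<epsilon>)" if "\<epsilon> \<in> index_set" for \<epsilon>
  proof (rule continuous_on_compose)
    show "continuous_on UNIV (x \<epsilon>)"
      using continuous_on_vec_lambda[of UNIV "\<lambda>i t. x \<epsilon> t $ i"] 0(2) that
      by (simp add: component_def)
    show "continuous_on (range (x \<epsilon>)) (f \<epsilon>)"
      using 0(1) that smooth_continuous[of "f \<epsilon>" "[]"] by (simp add: moderate_iff)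
  qed
  moreover
  have "moderately_bounded f"
    using 0(1) by (auto simp: moderate_iff dest: spec[of _ "[]"])
  from moderately_bounded_compose[OF this assms(2)]
  have "moderately_bounded (\<lambda>\<epsilon>. f \<epsilon> \<circ> x \<epsilon>)" by (simp add: o_def)
  ultimately show ?case unfolding moderate_upto.simps by blast
next
  case (Suc k)
  have "\<forall>i. \<exists>v. (\<forall>\<epsilon>\<in>index_set. \<forall>t. ((\<lambda>t. x \<epsilon> t $ i) has_real_derivative v \<epsilon> t) (at t)) \<and>
      moderate_upto k v"
    using Suc.prems(2) by (simp add: component_def)
  from choice[OF this] obtain v where v: "\<And>i \<epsilon> t. \<epsilon> \<in> index_set \<Longrightarrow> ((\<lambda>t. x \<epsilon> t $ i) has_real_derivative v i \<epsilon> t) (at t)"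
    "\<And>i. moderate_upto k (v i)"
    by blast
  let ?d = "\<lambda>\<epsilon> t. \<Sum>i\<in>UNIV. v i \<epsilon> t * partial_deriv [axis i 1] (f \<epsilon>) (x \<epsilon> t)"
  have "moderate_upto k (\<lambda>\<epsilon>. partial_deriv [axis i 1] (f \<epsilon>) \<circ> x \<epsilon>)" for i
    using Suc.prems(1) Suc.prems(2)[THEN moderate_upto_mono]
    by (intro Suc.IH moderate_partial_deriv) (auto simp: axis_in_Basis_iff)
  then have "moderate_upto k ?d"
    by (intro moderate_upto_sum moderate_upto_mult v) (simp add: o_def)
  moreover have "\<forall>\<epsilon>\<in>index_set. \<forall>t. ((f \<epsilon> \<circ> x \<epsilon>) has_real_derivative ?d \<epsilon> t) (at t)"
  proof (intro ballI allI)
    fix \<epsilon> t :: real assume \<epsilon>: "\<epsilon> \<in> index_set"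
    have "smooth (f \<epsilon>)" using Suc.prems(1) \<epsilon> by (simp add: moderate_iff)
    from has_real_derivative_compose_vec[OF this, of "x \<epsilon>" "\<chi> i. v i \<epsilon> t" t] v(1)[OF \<epsilon>]
    show "((f \<epsilon> \<circ> x \<epsilon>) has_real_derivative ?d \<epsilon> t) (at t)" by (simp add: o_def)
  qed
  moreover
  have "moderately_bounded f"
    using Suc.prems(1) by (auto simp: moderate_iff dest: spec[of _ "[]"])
  from moderately_bounded_compose[OF this assms(2)]
  have "moderately_bounded (\<lambda>\<epsilon>. f \<epsilon> \<circ> x \<epsilon>)" by (simp add: o_def)
  ultimately show ?case unfolding moderate_upto.simps
    by (intro conjI exI[of _ ?d])
qed

lemma moderate_compose:
  fixes f :: "(real ^ 'n, real) net" and x :: "(real, real ^ 'n) net"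
  assumes "f \<in> moderate" "x \<in> c_bounded_nets"
  shows "(\<lambda>\<epsilon>. f \<epsilon> \<circ> x \<epsilon>) \<in> moderate"
  using assms unfolding c_bounded_nets_def moderate_iff_moderate_upto[of "\<lambda>\<epsilon>. f \<epsilon> \<circ> x \<epsilon>"]
  by (auto intro: moderate_upto_compose moderate_imp_moderate_upto)

text \<open>Interpolation in the spirit of Landau and Kolmogorov: the difference quotient over a
  step \<open>h\<close> is bounded by twice the size of \<open>u\<close> divided by
  \<open>h\<close>, and it differs from the derivative by at most \<open>h\<close> times the second
  derivative, which is moderate. A suitable power of \<epsilon> for \<open>h\<close> makes both
  small.\<close>

lemma rapidly_small_partial_deriv:
  fixes u :: "(real, real) net"
  assumes u: "u \<in> moderate" and small: "rapidly_small u"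
  shows "rapidly_small (\<lambda>\<epsilon>. partial_deriv [1] (u \<epsilon>))"
proof (rule rapidly_smallI_const)
  fix K :: "real set" and q :: nat assume "compact K"
  then obtain R where R: "\<And>t. t \<in> K \<Longrightarrow> \<bar>t\<bar> \<le> R"
    by (metis compact_imp_bounded bounded_iff real_norm_def)
  \<comment> \<open>The margin 1 is there because \<open>t + h\<close> and the intermediate points
    may leave \<open>K\<close>, while \<open>h\<close> is at most 1.\<close>
  let ?K = "{-R-1..R+1}"
  have "moderately_bounded (\<lambda>\<epsilon>. partial_deriv [1, 1] (u \<epsilon>))"
    using u unfolding moderate_iff by (metis Basis_real_def empty_set list.simps(15) insert_absorb2 subset_refl)
  then obtain N :: nat where
    N: "\<forall>\<^sub>F \<epsilon> in at_right 0. \<forall>t\<in>?K. norm (partial_deriv [1, 1] (u \<epsilon>) t) \<le> 1 / \<epsilon> ^ N"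
    unfolding moderately_bounded_def by blast
  have "\<forall>\<^sub>F \<epsilon> in at_right 0. \<forall>t\<in>?K. norm (u \<epsilon> t) \<le> \<epsilon> ^ (2 * q + N)"
    using small unfolding rapidly_small_def by blast
  with N eventually_index_set
  have "\<forall>\<^sub>F \<epsilon> in at_right 0. \<forall>t\<in>K. norm (partial_deriv [1] (u \<epsilon>) t) \<le> 3 * \<epsilon> ^ q"
  proof eventually_elim
    case (elim \<epsilon>)
    \<comment> \<open>Balances the two errors: \<open>2 * \<epsilon> ^ (2 * q + N) / h\<close> is
      \<open>2 * \<epsilon> ^ q\<close> and \<open>h / \<epsilon> ^ N\<close> is
      \<open>\<epsilon> ^ q\<close>, together \<open>3 * \<epsilon> ^ q\<close>.\<close>
    define h where "h = \<epsilon> ^ (q + N)"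
    have h: "0 < h" "h \<le> 1" using elim(2) by (auto simp: h_def power_le_one)
    show ?case
    proof
      fix t assume t: "t \<in> K"
      have d1: "(u \<epsilon> has_real_derivative partial_deriv [1] (u \<epsilon>) s) (at s)" for s
        using u elim(2) by (rule moderate_has_derivative)
      have d2: "(partial_deriv [1] (u \<epsilon>) has_real_derivative partial_deriv [1, 1] (u \<epsilon>) s) (at s)" for s
      proof -
        have "(\<lambda>\<epsilon>. partial_deriv [1] (u \<epsilon>)) \<in> moderate" by (rule moderate_partial_deriv[OF u]) simp
        from moderate_has_derivative[OF this elim(2)] show ?thesis
          by (simp only: partial_deriv_append[symmetric] append.simps)
      qed
      obtain \<xi> where \<xi>: "t < \<xi>" "\<xi> < t + h" "u \<epsilon> (t + h) - u \<epsilon> t = h * partial_deriv [1] (u \<epsilon>) \<xi>"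
        using MVT2[of t "t + h" "u \<epsilon>", OF _ d1] h by auto
      obtain \<eta> where \<eta>: "t < \<eta>" "\<eta> < \<xi>"
        "partial_deriv [1] (u \<epsilon>) \<xi> - partial_deriv [1] (u \<epsilon>) t = (\<xi> - t) * partial_deriv [1, 1] (u \<epsilon>) \<eta>"
        using MVT2[OF \<xi>(1) d2] by auto
      have in_K: "t \<in> ?K" "t + h \<in> ?K" "\<eta> \<in> ?K"
        using R[OF t] h \<xi> \<eta> by auto
      have "h * \<bar>partial_deriv [1] (u \<epsilon>) \<xi>\<bar> = \<bar>u \<epsilon> (t + h) - u \<epsilon> t\<bar>"
        using h by (simp only: \<xi>(3) abs_mult abs_of_pos)
      also have "\<dots> \<le> 2 * \<epsilon> ^ (2 * q + N)"
        using elim(3) in_K(1,2) by (smt (verit) real_norm_def)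
      also have "\<dots> = h * (2 * \<epsilon> ^ q)"
      proof -
        have "2 * q + N = (q + N) + q" by simp
        then have "\<epsilon> ^ (2 * q + N) = h * \<epsilon> ^ q" by (simp only: h_def power_add)
        then show ?thesis by simp
      qed
      finally have 1: "\<bar>partial_deriv [1] (u \<epsilon>) \<xi>\<bar> \<le> 2 * \<epsilon> ^ q" using h(1) by (rule mult_left_le_imp_le)
      have "\<bar>partial_deriv [1] (u \<epsilon>) \<xi> - partial_deriv [1] (u \<epsilon>) t\<bar> = (\<xi> - t) * \<bar>partial_deriv [1, 1] (u \<epsilon>) \<eta>\<bar>"
        unfolding \<eta>(3) abs_mult using \<xi>(1) by simp
      also have "\<dots> \<le> h * (1 / \<epsilon> ^ N)"
        using \<xi> elim(1) in_K(3) by (intro mult_mono) auto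
      also have "\<dots> = \<epsilon> ^ q" using elim(2) by (simp add: h_def power_add)
      finally show "norm (partial_deriv [1] (u \<epsilon>) t) \<le> 3 * \<epsilon> ^ q" using 1 unfolding real_norm_def by linarith
    qed
  qed
  then show "\<exists>c. \<forall>\<^sub>F \<epsilon> in at_right 0. \<forall>t\<in>K. norm (partial_deriv [1] (u \<epsilon>) t) \<le> c * \<epsilon> ^ q" by blast
qed

text \<open>The sum of the absolute partial derivatives dominates the operator norm of the
  derivative, and so bounds the Lipschitz constant in \<open>rapidly_small_compose\<close>.\<close>

lemma moderately_bounded_gradient:
  fixes f :: "(real ^ 'n, real) net"
  assumes "f \<in> moderate"
  shows "moderately_bounded (\<lambda>\<epsilon> x. \<Sum>i\<in>UNIV. \<bar>partial_deriv [axis i 1] (f \<epsilon>) x\<bar>)"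
proof -
  have "moderately_bounded (\<lambda>\<epsilon>. partial_deriv [axis i 1] (f \<epsilon>))" for i :: 'n
  proof -
    have "set [axis i (1::real)] \<subseteq> Basis" by (simp add: axis_in_Basis_iff)
    then show ?thesis using assms unfolding moderate_iff by blast
  qed
  then have abs: "moderately_bounded (\<lambda>\<epsilon> x. \<bar>partial_deriv [axis i 1] (f \<epsilon>) x\<bar>)" for i :: 'n
    by (simp add: moderately_bounded_def)
  have "moderately_bounded (\<lambda>\<epsilon> x. \<Sum>i\<in>A. \<bar>partial_deriv [axis i 1] (f \<epsilon>) x\<bar>)" if "finite A" for A :: "'n set"
    using that
  proof induction
    case empty
    have "\<forall>\<^sub>F \<epsilon> in at_right 0. \<forall>x\<in>K. norm (0::real) \<le> 1 / \<epsilon> ^ 0" for K :: "(real ^ 'n) set" by simp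
    then show ?case unfolding moderately_bounded_def sum.empty by blast
  next
    case (insert i A)
    from moderately_bounded_add[OF abs[of i] insert.IH] show ?case
      by (simp only: sum.insert[OF insert.hyps])
  qed
  then show ?thesis by simp
qed

text \<open>Balls take the place of arbitrary compact sets because the mean value inequality needs a
  convex set.\<close>

lemma c_bounded_cball:
  assumes "c_bounded x" "compact K"
  obtains R where "R > 0" "\<forall>\<^sub>F \<epsilon> in at_right 0. x \<epsilon> ` K \<subseteq> cball 0 R"
proof -
  obtain K' where K': "compact K'" "\<forall>\<^sub>F \<epsilon> in at_right 0. x \<epsilon> ` K \<subseteq> K'"
    using c_boundedD[OF assms] .
  then obtain R where "R > 0" "K' \<subseteq> cball 0 R"
    by (metis ball_subset_cball bounded_subset_ballD compact_imp_bounded order_trans)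
  with K'(2) that show thesis by (meson eventually_mono subset_trans)
qed

text \<open>Split the difference at \<open>f \<epsilon> (y \<epsilon> t)\<close>. The part
  \<open>f - g\<close> is small on a compact set; for the other part the moderate gradient of
  \<open>f\<close> costs a fixed power of \<epsilon>, which the smallness of \<open>x - y\<close>
  repays. This makes compositions independent of representatives.\<close>

lemma rapidly_small_compose:
  fixes f g :: "(real ^ 'n, real) net" and x y :: "('a::euclidean_space, real ^ 'n) net"
  assumes f: "f \<in> moderate" and fg: "rapidly_small (\<lambda>\<epsilon> z. f \<epsilon> z - g \<epsilon> z)"
    and x: "c_bounded x" and y: "c_bounded y" and xy: "rapidly_small (\<lambda>\<epsilon> t. x \<epsilon> t - y \<epsilon> t)"
  shows "rapidly_small (\<lambda>\<epsilon> t. f \<epsilon> (x \<epsilon> t) - g \<epsilon> (y \<epsilon> t))"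
proof (rule rapidly_smallI_const)
  fix K :: "'a set" and q :: nat assume K: "compact K"
  obtain R1 R2 where R12: "\<forall>\<^sub>F \<epsilon> in at_right 0. x \<epsilon> ` K \<subseteq> cball 0 R1"
    "\<forall>\<^sub>F \<epsilon> in at_right 0. y \<epsilon> ` K \<subseteq> cball 0 R2"
    using c_bounded_cball[OF x K] c_bounded_cball[OF y K] by metis
  \<comment> \<open>The larger radius puts both images into one convex set.\<close>
  define B where "B = cball (0::real^'n) (max R1 R2)"
  have cB: "compact B" by (simp add: B_def)
  obtain N :: nat where N: "\<forall>\<^sub>F \<epsilon> in at_right 0. \<forall>z\<in>B.
      norm (\<Sum>i\<in>UNIV. \<bar>partial_deriv [axis i 1] (f \<epsilon>) z\<bar>) \<le> 1 / \<epsilon> ^ N"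
    using moderately_bounded_gradient[OF f] cB unfolding moderately_bounded_def by blast
  have "\<forall>\<^sub>F \<epsilon> in at_right 0. \<forall>z\<in>B. norm (f \<epsilon> z - g \<epsilon> z) \<le> \<epsilon> ^ q"
    using fg cB unfolding rapidly_small_def by blast
  \<comment> \<open>The surplus \<open>N\<close> cancels the gradient bound
    \<open>1 / \<epsilon> ^ N\<close>.\<close>
  moreover have "\<forall>\<^sub>F \<epsilon> in at_right 0. \<forall>t\<in>K. norm (x \<epsilon> t - y \<epsilon> t) \<le> \<epsilon> ^ (N + q)"
    using xy K unfolding rapidly_small_def by blast
  ultimately have "\<forall>\<^sub>F \<epsilon> in at_right 0. \<forall>t\<in>K. norm (f \<epsilon> (x \<epsilon> t) - g \<epsilon> (y \<epsilon> t)) \<le> 2 * \<epsilon> ^ q"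
    using N R12 eventually_index_set
  proof eventually_elim
    case (elim \<epsilon>)
    show ?case
    proof
      fix t assume t: "t \<in> K"
      have B: "x \<epsilon> t \<in> B" "y \<epsilon> t \<in> B" using elim(4,5) t by (force simp: B_def)+
      have "smooth (f \<epsilon>)" using f elim(6) by (simp add: moderate_iff)
      note D = smooth_derivative_eq[OF this]
      have "norm (f \<epsilon> (x \<epsilon> t) - f \<epsilon> (y \<epsilon> t)) \<le> 1 / \<epsilon> ^ N * norm (x \<epsilon> t - y \<epsilon> t)"
      proof (rule differentiable_bound[OF _ _ _ B])
        show "convex B" by (simp add: B_def)
        show "(f \<epsilon> has_derivative (\<lambda>h. \<Sum>i\<in>UNIV. h $ i * partial_deriv [axis i 1] (f \<epsilon>) z)) (at z within B)" for z
          using D by (rule has_derivative_at_withinI)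
        fix z assume z: "z \<in> B"
        show "onorm (\<lambda>h. \<Sum>i\<in>UNIV. h $ i * partial_deriv [axis i 1] (f \<epsilon>) z) \<le> 1 / \<epsilon> ^ N"
        proof (rule onorm_bound)
          show "0 \<le> 1 / \<epsilon> ^ N" using elim(6) by simp
          fix h :: "real ^ 'n"
          let ?S = "\<Sum>i\<in>UNIV. \<bar>partial_deriv [axis i 1] (f \<epsilon>) z\<bar>"
          have "norm (\<Sum>i\<in>UNIV. h $ i * partial_deriv [axis i 1] (f \<epsilon>) z)
              \<le> (\<Sum>i\<in>UNIV. norm h * \<bar>partial_deriv [axis i 1] (f \<epsilon>) z\<bar>)"
            using component_le_norm_cart[of h]
            by (intro order.trans[OF norm_sum] sum_mono) (auto simp only: real_norm_def abs_mult intro!: mult_right_mono)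
          also have "\<dots> = ?S * norm h" by (simp only: sum_distrib_left[symmetric] mult.commute)
          also have "\<dots> \<le> 1 / \<epsilon> ^ N * norm h"
            using elim(3) z by (intro mult_right_mono) (auto simp only: real_norm_def norm_ge_zero)
          finally show "norm (\<Sum>i\<in>UNIV. h $ i * partial_deriv [axis i 1] (f \<epsilon>) z) \<le> 1 / \<epsilon> ^ N * norm h" .
        qed
      qed
      also have "\<dots> \<le> 1 / \<epsilon> ^ N * \<epsilon> ^ (N + q)"
        using elim(2,6) t by (intro mult_left_mono) auto
      also have "\<dots> = \<epsilon> ^ q" using elim(6) by (simp add: power_add)
      finally have 1: "norm (f \<epsilon> (x \<epsilon> t) - f \<epsilon> (y \<epsilon> t)) \<le> \<epsilon> ^ q" .
      have "norm (f \<epsilon> (y \<epsilon> t) - g \<epsilon> (y \<epsilon> t)) \<le> \<epsilon> ^ q" using elim(1) B(2) by blast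
      with 1 show "norm (f \<epsilon> (x \<epsilon> t) - g \<epsilon> (y \<epsilon> t)) \<le> 2 * \<epsilon> ^ q"
        unfolding real_norm_def by linarith
    qed
  qed
  then show "\<exists>c. \<forall>\<^sub>F \<epsilon> in at_right 0. \<forall>t\<in>K. norm (f \<epsilon> (x \<epsilon> t) - g \<epsilon> (y \<epsilon> t)) \<le> c * \<epsilon> ^ q" by blast
qed

section \<open>Global solutions of ordinary differential equations\<close>

lemma gronwall_forward:
  fixes z :: "real \<Rightarrow> 'a::real_inner"
  assumes "0 \<le> L" "0 \<le> \<eta>" "0 \<le> T"
    and z: "\<And>t. t\<^sub>0 \<le> t \<Longrightarrow> t \<le> t\<^sub>0 + T \<Longrightarrow> (z has_vector_derivative z' t) (at t)"
    and z': "\<And>t. t\<^sub>0 \<le> t \<Longrightarrow> t \<le> t\<^sub>0 + T \<Longrightarrow> norm (z' t) \<le> L * norm (z t) + \<eta>"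
  shows "norm (z (t\<^sub>0 + T)) \<le> exp (L * T) * (norm (z t\<^sub>0) + \<eta> * T)"
proof (rule field_le_epsilon)
  fix e :: real assume "e > 0"
  \<comment> \<open>Chosen so that, after multiplication by \<open>exp (L * T)\<close>, the
    regularisation contributes exactly \<open>e\<close>.\<close>
  define \<delta> where "\<delta> = e / exp (L * T)"
  have \<delta>: "\<delta> > 0" using \<open>e > 0\<close> by (simp add: \<delta>_def)
  \<comment> \<open>\<open>\<delta>\<close> makes the norm of \<open>z\<close> differentiable also where \<open>z\<close> vanishes.\<close>
  define \<phi> where "\<phi> t = sqrt (z t \<bullet> z t + \<delta>\<^sup>2)" for t
  \<comment> \<open>The subtracted linear term absorbs \<eta>: the integrating factor is at most 1
    from \<open>t\<^sub>0\<close> on, so the derivative of \<open>w\<close> is nonpositive.\<close>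
  define w where "w t = exp (- L * (t - t\<^sub>0)) * \<phi> t - \<eta> * (t - t\<^sub>0)" for t
  have pos: "0 < z t \<bullet> z t + \<delta>\<^sup>2" for t using \<delta> by (simp add: add_nonneg_pos)
  have norm_le: "norm (z t) \<le> \<phi> t" for t
    unfolding \<phi>_def norm_eq_sqrt_inner by simp
  have "w (t\<^sub>0 + T) \<le> w t\<^sub>0"
  proof (rule DERIV_nonpos_imp_nonincreasing[of t\<^sub>0 "t\<^sub>0 + T" w])
    show "t\<^sub>0 \<le> t\<^sub>0 + T" using assms by simp
    fix t assume t: "t\<^sub>0 \<le> t" "t \<le> t\<^sub>0 + T"
    define D where "D = (z t \<bullet> z' t) / \<phi> t"
    have "((\<lambda>t. z t \<bullet> z t + \<delta>\<^sup>2) has_derivative (\<lambda>h. h * (2 * (z t \<bullet> z' t)))) (at t)"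
      using z[OF t] unfolding has_vector_derivative_def
      by (auto intro!: derivative_eq_intros simp: inner_commute algebra_simps)
    then have "((\<lambda>t. z t \<bullet> z t + \<delta>\<^sup>2) has_real_derivative 2 * (z t \<bullet> z' t)) (at t)"
      by (simp add: has_field_derivative_def mult_commute_abs)
    then have "((\<lambda>t. sqrt (z t \<bullet> z t + \<delta>\<^sup>2)) has_real_derivative
        inverse (sqrt (z t \<bullet> z t + \<delta>\<^sup>2)) / 2 * (2 * (z t \<bullet> z' t))) (at t)"
      using DERIV_chain2[where f = sqrt and g = "\<lambda>t. z t \<bullet> z t + \<delta>\<^sup>2"] DERIV_real_sqrt[OF pos[of t]]
      by blast
    then have \<phi>': "(\<phi> has_real_derivative D) (at t)"
      unfolding \<phi>_def D_def by (simp add: field_simps)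
    have "(w has_real_derivative exp (- L * (t - t\<^sub>0)) * (D - L * \<phi> t) - \<eta>) (at t)"
      unfolding w_def by (rule derivative_eq_intros \<phi>' refl)+ (simp add: algebra_simps)
    moreover have "exp (- L * (t - t\<^sub>0)) * (D - L * \<phi> t) - \<eta> \<le> 0"
    proof -
      have "\<phi> t > 0" using pos by (simp add: \<phi>_def)
      have "z t \<bullet> z' t \<le> norm (z t) * norm (z' t)" by (rule norm_cauchy_schwarz)
      also have "\<dots> \<le> \<phi> t * norm (z' t)" using norm_le by (intro mult_right_mono) auto
      finally have "D \<le> norm (z' t)" using \<open>\<phi> t > 0\<close> by (simp add: D_def field_simps)
      also have "\<dots> \<le> L * \<phi> t + \<eta>"
        using z'[OF t] mult_left_mono[OF norm_le \<open>0 \<le> L\<close>, of t] by linarith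
      finally have "exp (- L * (t - t\<^sub>0)) * (D - L * \<phi> t) \<le> exp (- L * (t - t\<^sub>0)) * \<eta>"
        by (intro mult_left_mono) auto
      also have "\<dots> \<le> 1 * \<eta>" using assms t by (intro mult_right_mono) auto
      finally show ?thesis by simp
    qed
    ultimately show "\<exists>y. (w has_real_derivative y) (at t) \<and> y \<le> 0" by blast
  qed
  then have "exp (- L * T) * \<phi> (t\<^sub>0 + T) \<le> \<phi> t\<^sub>0 + \<eta> * T" by (simp add: w_def)
  then have "\<phi> (t\<^sub>0 + T) \<le> exp (L * T) * (\<phi> t\<^sub>0 + \<eta> * T)"
    by (simp add: exp_minus field_simps)
  also have "\<phi> t\<^sub>0 \<le> norm (z t\<^sub>0) + \<delta>"
    using sqrt_add_le_add_sqrt[of "z t\<^sub>0 \<bullet> z t\<^sub>0" "\<delta>\<^sup>2"] \<delta> by (simp add: \<phi>_def norm_eq_sqrt_inner)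
  finally have "\<phi> (t\<^sub>0 + T) \<le> exp (L * T) * (norm (z t\<^sub>0) + \<delta> + \<eta> * T)" by simp
  also have "\<dots> = exp (L * T) * (norm (z t\<^sub>0) + \<eta> * T) + e" by (simp add: \<delta>_def field_simps)
  finally show "norm (z (t\<^sub>0 + T)) \<le> exp (L * T) * (norm (z t\<^sub>0) + \<eta> * T) + e"
    using norm_le[of "t\<^sub>0 + T"] by linarith
qed

lemma has_vector_derivative_reflect:
  fixes z :: "real \<Rightarrow> 'a::real_normed_vector"
  assumes "(z has_vector_derivative d) (at (2 * t\<^sub>0 - t))"
  shows "((\<lambda>t. z (2 * t\<^sub>0 - t)) has_vector_derivative - d) (at t)"
proof -
  have "((\<lambda>t. 2 * t\<^sub>0 - t) has_vector_derivative - 1) (at t)"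
    by (auto intro!: derivative_eq_intros)
  from vector_diff_chain_at[OF this assms] show ?thesis by (simp add: o_def)
qed

lemma gronwall:
  fixes z :: "real \<Rightarrow> 'a::real_inner"
  assumes "0 \<le> L" "0 \<le> \<eta>"
    and z: "\<And>t. \<bar>t - t\<^sub>0\<bar> \<le> T \<Longrightarrow> (z has_vector_derivative z' t) (at t)"
    and z': "\<And>t. \<bar>t - t\<^sub>0\<bar> \<le> T \<Longrightarrow> norm (z' t) \<le> L * norm (z t) + \<eta>"
    and t: "\<bar>t - t\<^sub>0\<bar> \<le> T"
  shows "norm (z t) \<le> exp (L * T) * (norm (z t\<^sub>0) + \<eta> * T)"
proof -
  define S where "S = \<bar>t - t\<^sub>0\<bar>"
  have S: "0 \<le> S" "S \<le> T" using t by (auto simp: S_def)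
  have "norm (z t) \<le> exp (L * S) * (norm (z t\<^sub>0) + \<eta> * S)"
  proof (cases "t\<^sub>0 \<le> t")
    case True
    then have "t = t\<^sub>0 + S" by (simp add: S_def)
    then show ?thesis using gronwall_forward[of L \<eta> S t\<^sub>0 z z'] assms S by simp
  next
    case False
    then have "t = 2 * t\<^sub>0 - (t\<^sub>0 + S)" by (simp add: S_def)
    \<comment> \<open>Backward time is forward time for the path reflected at
      \<open>t\<^sub>0\<close>.\<close>
    moreover have "norm (z (2 * t\<^sub>0 - (t\<^sub>0 + S))) \<le>
        exp (L * S) * (norm (z (2 * t\<^sub>0 - t\<^sub>0)) + \<eta> * S)"
      by (rule gronwall_forward[where z' = "\<lambda>s. - z' (2 * t\<^sub>0 - s)"])
        (use assms(1,2) S in \<open>auto intro!: has_vector_derivative_reflect z z'\<close>)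
    ultimately show ?thesis by simp
  qed
  also have "\<dots> \<le> exp (L * T) * (norm (z t\<^sub>0) + \<eta> * T)"
    using assms(1,2) S by (intro mult_mono add_mono) (auto simp: mult_left_mono)
  finally show ?thesis .
qed

section \<open>Picard's theorem for a globally Lipschitz field\<close>

lemma antiderivative_exists:
  fixes h :: "real \<Rightarrow> 'a::banach"
  assumes "continuous_on UNIV h"
  shows "\<exists>G. G t\<^sub>0 = 0 \<and> (\<forall>t. (G has_vector_derivative h t) (at t))"
proof -
  \<comment> \<open>An oriented integral: one of the two terms vanishes, depending on the side of
    \<open>t\<^sub>0\<close> on which \<open>t\<close> lies.\<close>
  define G where "G t = integral {t\<^sub>0..t} h - integral {t..t\<^sub>0} h" for t
  have int: "h integrable_on {a..b}" for a b
    using assms continuous_on_subset by (intro integrable_continuous_interval) blast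
  have "(G has_vector_derivative h t) (at t)" for t
  proof -
    \<comment> \<open>Both \<open>t\<close> and \<open>t\<^sub>0\<close> are interior to this
      interval, so all integrals can start at \<open>a\<close> and the derivative within the
      interval is a two-sided one.\<close>
    define a b where "a = min t t\<^sub>0 - 1" and "b = max t t\<^sub>0 + 1"
    have G: "G s = integral {a..s} h - integral {a..t\<^sub>0} h" if "s \<in> {a<..<b}" for s
    proof (cases "t\<^sub>0 \<le> s")
      case True
      have "integral {a..t\<^sub>0} h + integral {t\<^sub>0..s} h = integral {a..s} h"
        by (rule Henstock_Kurzweil_Integration.integral_combine) (use True int in \<open>auto simp: a_def\<close>)
      moreover have "integral {s..t\<^sub>0} h = 0"
        using True by (cases "s = t\<^sub>0") auto
      ultimately show ?thesis by (simp add: G_def algebra_simps)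
    next
      case False
      have "integral {a..s} h + integral {s..t\<^sub>0} h = integral {a..t\<^sub>0} h"
        by (rule Henstock_Kurzweil_Integration.integral_combine) (use False that int in auto)
      then show ?thesis using False by (simp add: G_def algebra_simps)
    qed
    have "((\<lambda>s. integral {a..s} h) has_vector_derivative h t) (at t within {a..b})"
      using assms continuous_on_subset
      by (intro integral_has_vector_derivative) (auto simp: a_def b_def)
    moreover have "at t within {a..b} = at t"
      by (rule at_within_interior) (auto simp: a_def b_def)
    ultimately have "((\<lambda>s. integral {a..s} h - integral {a..t\<^sub>0} h) has_vector_derivative h t) (at t)"
      by (auto intro!: derivative_eq_intros)
    then show ?thesis
      by (rule has_vector_derivative_transform_within_open[of _ _ _ "{a<..<b}"])
        (auto simp: G a_def b_def)
  qed
  moreover have "G t\<^sub>0 = 0" by (simp add: G_def)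
  ultimately show ?thesis by blast
qed

text \<open>Integrating the weight divides it by \<open>c\<close>. In the Picard argument this
  quotient becomes the contraction constant.\<close>

lemma norm_antiderivative_exp_forward:
  fixes G :: "real \<Rightarrow> 'a::real_normed_vector"
  assumes "c > 0" "A \<ge> 0" "G t\<^sub>0 = 0"
    and G: "\<And>t. (G has_vector_derivative h t) (at t)"
    and h: "\<And>t. norm (h t) \<le> A * exp (c * \<bar>t - t\<^sub>0\<bar>)"
    and t: "t\<^sub>0 \<le> t"
  shows "norm (G t) \<le> A / c * exp (c * \<bar>t - t\<^sub>0\<bar>)"
proof (cases "t = t\<^sub>0")
  case False
  with t have "t\<^sub>0 < t" by simp
  let ?\<phi> = "\<lambda>s. A / c * exp (c * (s - t\<^sub>0))"
  have "norm (G t - G t\<^sub>0) \<le> ?\<phi> t - ?\<phi> t\<^sub>0"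
  proof (rule differentiable_bound_general[OF \<open>t\<^sub>0 < t\<close>])
    show "continuous_on {t\<^sub>0..t} G"
      using G by (intro continuous_at_imp_continuous_on) (auto intro: has_vector_derivative_continuous)
    show "continuous_on {t\<^sub>0..t} ?\<phi>" by (intro continuous_intros)
    show "(G has_vector_derivative h s) (at s)" for s by (rule G)
    show "(?\<phi> has_vector_derivative A * exp (c * (s - t\<^sub>0))) (at s)" for s
      unfolding has_real_derivative_iff_has_vector_derivative[symmetric]
      using \<open>c > 0\<close> by (auto intro!: derivative_eq_intros)
    show "norm (h s) \<le> A * exp (c * (s - t\<^sub>0))" if "t\<^sub>0 < s" for s using h[of s] that by simp
  qed
  moreover have "?\<phi> t\<^sub>0 \<ge> 0" using assms(1,2) by simp
  ultimately show ?thesis using assms(3) t by simp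
qed (use assms in simp)

lemma norm_antiderivative_exp:
  fixes G :: "real \<Rightarrow> 'a::real_normed_vector"
  assumes "c > 0" "A \<ge> 0" "G t\<^sub>0 = 0"
    and G: "\<And>t. (G has_vector_derivative h t) (at t)"
    and h: "\<And>t. norm (h t) \<le> A * exp (c * \<bar>t - t\<^sub>0\<bar>)"
  shows "norm (G t) \<le> A / c * exp (c * \<bar>t - t\<^sub>0\<bar>)"
proof (cases "t\<^sub>0 \<le> t")
  case True
  with norm_antiderivative_exp_forward[OF assms] show ?thesis by blast
next
  case False
  have "norm (G (2 * t\<^sub>0 - (2 * t\<^sub>0 - t))) \<le> A / c * exp (c * \<bar>(2 * t\<^sub>0 - t) - t\<^sub>0\<bar>)"
  proof (rule norm_antiderivative_exp_forward[where h = "\<lambda>s. - h (2 * t\<^sub>0 - s)", OF assms(1,2)])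
    show "((\<lambda>s. G (2 * t\<^sub>0 - s)) has_vector_derivative - h (2 * t\<^sub>0 - s)) (at s)" for s
      by (rule has_vector_derivative_reflect[OF G])
    show "norm (- h (2 * t\<^sub>0 - s)) \<le> A * exp (c * \<bar>s - t\<^sub>0\<bar>)" for s
      using h[of "2 * t\<^sub>0 - s"] by (simp add: abs_minus_commute)
  qed (use False assms(3) in auto)
  then show ?thesis by (simp add: abs_minus_commute)
qed

text \<open>
  The Picard operator is a contraction with constant \<open>1 / 2\<close> for the norm weighted by
  \<open>exp (- 2 * L * \<bar>t - t\<^sub>0\<bar>)\<close>, so a single fixed point yields the solution on the whole line.
\<close>

lemma lipschitz_ode_solution:
  fixes g :: "'a::banach \<Rightarrow> 'a"
  assumes lip: "\<And>x y. norm (g x - g y) \<le> L * norm (x - y)"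
  shows "\<exists>x. x t\<^sub>0 = x\<^sub>0 \<and> (\<forall>t. (x has_vector_derivative g (x t)) (at t))"
proof -
  \<comment> \<open>Strictly positive even if \<open>L\<close> is not, as the division by
    \<open>c\<close> below requires.\<close>
  define M where "M = \<bar>L\<bar> + 1"
  have M: "M > 0" by (simp add: M_def)
  have lipM: "norm (g x - g y) \<le> M * norm (x - y)" for x y
  proof -
    have "L * norm (x - y) \<le> M * norm (x - y)" by (intro mult_right_mono) (auto simp: M_def)
    with lip[of x y] show ?thesis by linarith
  qed
  \<comment> \<open>Integration produces the factor \<open>M / c\<close>, here 1 / 2.\<close>
  define c where "c = 2 * M"
  have c: "c > 0" using M by (simp add: c_def)
  have cont_g: "continuous_on S g" for S
    using M lipM by (intro lipschitz_on_continuous_on[of M] lipschitz_onI) (auto simp: dist_norm)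
  define E where "E t = exp (c * \<bar>t - t\<^sub>0\<bar>)" for t
  have E: "E t \<ge> 1" "E t > 0" for t using c by (auto simp: E_def)
  \<comment> \<open>A bounded continuous function stands for a path divided by the weight;
    \<open>X y\<close> is the actual path, allowed to grow like \<open>E\<close>.\<close>
  define X where "X y t = E t *\<^sub>R apply_bcontfun y t" for y :: "real \<Rightarrow>\<^sub>C 'a" and t
  have cont_X: "continuous_on UNIV (\<lambda>t. g (X y t))" for y
    unfolding X_def E_def
    by (intro continuous_on_compose2[OF cont_g[of UNIV]] continuous_intros) auto
  have "\<forall>y. \<exists>G. G t\<^sub>0 = 0 \<and> (\<forall>t. (G has_vector_derivative g (X y t)) (at t))"
    using antiderivative_exists[OF cont_X] by blast
  from choice[OF this] obtain G where G0: "\<And>y. G y t\<^sub>0 = 0"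
    and G: "\<And>y t. (G y has_vector_derivative g (X y t)) (at t)" by blast
  \<comment> \<open>The Picard image stays in the weighted space, since a Lipschitz field grows at
    most linearly and integration preserves growth of order \<open>E\<close>.\<close>
  have "(\<lambda>t. (1 / E t) *\<^sub>R (x\<^sub>0 + G y t)) \<in> bcontfun" for y
    unfolding bcontfun_def
  proof (intro CollectI conjI)
    have "continuous_on UNIV (G y)"
      using G by (intro continuous_at_imp_continuous_on) (auto intro: has_vector_derivative_continuous)
    then show "continuous_on UNIV (\<lambda>t. (1 / E t) *\<^sub>R (x\<^sub>0 + G y t))"
      unfolding E_def by (intro continuous_intros) auto
    obtain B where B: "\<And>t. norm (apply_bcontfun y t) \<le> B"
      using bounded_apply_bcontfun[of y] unfolding bounded_iff by blast
    have B0: "B \<ge> 0" using order.trans[OF norm_ge_zero B] .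
    define A where "A = norm (g 0) + M * B"
    have A: "A \<ge> 0" using M B0 by (simp add: A_def)
    have "norm (g (X y t)) \<le> A * E t" for t
    proof -
      have "norm (g (X y t)) \<le> norm (g 0) + norm (g (X y t) - g 0)"
        using norm_triangle_ineq[of "g 0" "g (X y t) - g 0"] by simp
      also have "\<dots> \<le> norm (g 0) * E t + M * (E t * B)"
      proof (rule add_mono)
        show "norm (g 0) \<le> norm (g 0) * E t" using mult_left_mono[OF E(1), of "norm (g 0)"] by simp
        have "norm (g (X y t) - g 0) \<le> M * norm (X y t)" using lipM[of "X y t" 0] by simp
        also have "\<dots> \<le> M * (E t * B)"
          using B M E(2)[of t] by (auto simp: X_def intro!: mult_left_mono)
        finally show "norm (g (X y t) - g 0) \<le> M * (E t * B)" .
      qed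
      finally show ?thesis by (simp add: A_def algebra_simps)
    qed
    from norm_antiderivative_exp[OF c A G0 G this[unfolded E_def]]
    have GE: "norm (G y t) \<le> A / c * E t" for t by (simp add: E_def)
    have "norm ((1 / E t) *\<^sub>R (x\<^sub>0 + G y t)) \<le> norm x\<^sub>0 + A / c" for t
    proof -
      have "norm (x\<^sub>0 + G y t) \<le> norm x\<^sub>0 * E t + A / c * E t"
        using norm_triangle_ineq[of x\<^sub>0 "G y t"] GE[of t] mult_left_mono[OF E(1)[of t], of "norm x\<^sub>0"]
        by simp
      then have "norm (x\<^sub>0 + G y t) / E t \<le> norm x\<^sub>0 + A / c"
        using E(2)[of t] by (simp add: pos_divide_le_eq distrib_right)
      then show ?thesis using E(2)[of t] by simp
    qed
    then show "bounded (range (\<lambda>t. (1 / E t) *\<^sub>R (x\<^sub>0 + G y t)))"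
      by (auto simp: bounded_iff)
  qed
  note in_bcontfun = this
  define P where "P y = Bcontfun (\<lambda>t. (1 / E t) *\<^sub>R (x\<^sub>0 + G y t))" for y
  have P: "apply_bcontfun (P y) t = (1 / E t) *\<^sub>R (x\<^sub>0 + G y t)" for y t
    unfolding P_def by (subst Bcontfun_inverse[OF in_bcontfun]) simp
  have "dist (P y) (P z) \<le> 1 / 2 * dist y z" for y z
  proof (rule dist_bound)
    fix t
    have "norm (g (X y s) - g (X z s)) \<le> (M * dist y z) * exp (c * \<bar>s - t\<^sub>0\<bar>)" for s
    proof -
      have "norm (g (X y s) - g (X z s)) \<le> M * norm (X y s - X z s)" by (rule lipM)
      also have "\<dots> = M * (E s * dist (apply_bcontfun y s) (apply_bcontfun z s))"
        using E(2)[of s] by (simp add: X_def dist_norm flip: scaleR_diff_right)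
      also have "\<dots> \<le> M * (E s * dist y z)"
        using M E(2)[of s] dist_bounded[of y s z] by (intro mult_left_mono) auto
      finally show ?thesis by (simp add: E_def mult_ac)
    qed
    then have "norm (G y t - G z t) \<le> M * dist y z / c * exp (c * \<bar>t - t\<^sub>0\<bar>)"
      using M by (intro norm_antiderivative_exp[where h = "\<lambda>s. g (X y s) - g (X z s)"])
        (auto intro!: has_vector_derivative_diff G c simp: G0)
    also have "\<dots> = 1 / 2 * dist y z * E t" using M by (simp add: c_def E_def)
    finally have "norm (G y t - G z t) \<le> 1 / 2 * dist y z * E t" .
    moreover have "dist (P y t) (P z t) = norm (G y t - G z t) / E t"
      using E(2)[of t] by (simp add: P dist_norm flip: scaleR_diff_right)
    ultimately show "dist (P y t) (P z t) \<le> 1 / 2 * dist y z"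
      using E(2)[of t] by (simp only: pos_divide_le_eq)
  qed
  then have "\<exists>!y. P y = y" by (intro banach_fix_type[of "1 / 2"]) auto
  then obtain y where y: "P y = y" by blast
  have X: "X y t = x\<^sub>0 + G y t" for t
    using P[of y t] E(2)[of t] by (simp add: y X_def)
  have "((\<lambda>t. x\<^sub>0 + G y t) has_vector_derivative g (X y t)) (at t)" for t
    using G[of y t] by (auto intro!: derivative_eq_intros)
  then show ?thesis by (intro exI[of _ "\<lambda>t. x\<^sub>0 + G y t"]) (auto simp: G0 X)
qed

text \<open>Gronwall with both constants equal to \<open>C\<close>, as
  \<open>C * (1 + norm x)\<close> is \<open>C * norm x + C\<close>. The bound depends on the field
  through \<open>C\<close> only and is therefore uniform in \<epsilon>.\<close>

lemma linear_growth_a_priori: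
  fixes x :: "real \<Rightarrow> 'a::real_inner"
  assumes "0 \<le> C" and g: "\<And>x. norm (g x) \<le> C * (1 + norm x)"
    and x: "\<And>t. \<bar>t - t\<^sub>0\<bar> \<le> T \<Longrightarrow> (x has_vector_derivative g (x t)) (at t)"
    and t: "\<bar>t - t\<^sub>0\<bar> \<le> T"
  shows "norm (x t) \<le> exp (C * T) * (norm (x t\<^sub>0) + C * T)"
  using g by (intro gronwall[OF assms(1,1) x _ t]) (auto simp: algebra_simps)

text \<open>The field is composed with the nearest-point projection onto a ball. This makes it
  globally Lipschitz and preserves its growth bound, as the projection is nonexpansive and fixes 0.
  The a priori estimate, valid for the modified field too, keeps the solution in the ball, where
  nothing was changed.\<close>

lemma ode_solution_interval:
  fixes f :: "'a::euclidean_space \<Rightarrow> 'a"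
  assumes lip: "\<And>R. \<exists>L. \<forall>x\<in>cball 0 R. \<forall>y\<in>cball 0 R. norm (f x - f y) \<le> L * norm (x - y)"
    and C: "0 \<le> C" and f: "\<And>x. norm (f x) \<le> C * (1 + norm x)"
    and T: "0 \<le> T"
  shows "\<exists>x. x t\<^sub>0 = x\<^sub>0 \<and> (\<forall>t. \<bar>t - t\<^sub>0\<bar> \<le> T \<longrightarrow> (x has_vector_derivative f (x t)) (at t))"
proof -
  define R where "R = exp (C * T) * (norm x\<^sub>0 + C * T)"
  have R: "0 \<le> R" using C T by (simp add: R_def)
  obtain L where L: "\<And>x y. x \<in> cball 0 R \<Longrightarrow> y \<in> cball 0 R \<Longrightarrow> norm (f x - f y) \<le> L * norm (x - y)"
    using lip by metis
  define p where "p = closest_point (cball (0::'a) R)"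
  have ne: "cball (0::'a) R \<noteq> {}" using R by simp
  have p_in: "p x \<in> cball 0 R" for x
    unfolding p_def by (rule closest_point_in_set) (use ne in auto)
  have p_lip: "norm (p x - p y) \<le> norm (x - y)" for x y
    unfolding p_def dist_norm[symmetric] by (rule closest_point_lipschitz) (use ne in auto)
  have p_id: "p x = x" if "x \<in> cball 0 R" for x
    unfolding p_def by (rule closest_point_self[OF that])
  have p_le: "norm (p x) \<le> norm x" for x
    using p_lip[of x 0] p_id[of 0] R by simp
  have "norm (f (p x) - f (p y)) \<le> \<bar>L\<bar> * norm (x - y)" for x y
  proof -
    have "norm (f (p x) - f (p y)) \<le> \<bar>L\<bar> * norm (p x - p y)"
      using L[OF p_in p_in, of x y] mult_right_mono[OF abs_ge_self, of "norm (p x - p y)" L] by simp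
    also have "\<dots> \<le> \<bar>L\<bar> * norm (x - y)" using p_lip by (intro mult_left_mono) auto
    finally show ?thesis .
  qed
  from lipschitz_ode_solution[where g = "\<lambda>x. f (p x)", OF this]
  obtain x where x: "x t\<^sub>0 = x\<^sub>0" "\<And>t. (x has_vector_derivative f (p (x t))) (at t)" by blast
  have "norm (f (p x)) \<le> C * (1 + norm x)" for x
    using f[of "p x"] mult_left_mono[OF p_le C, of x] by (simp add: algebra_simps)
  then have "norm (x t) \<le> exp (C * T) * (norm (x t\<^sub>0) + C * T)" if "\<bar>t - t\<^sub>0\<bar> \<le> T" for t
    by (rule linear_growth_a_priori[where g = "\<lambda>x. f (p x)", OF C _ x(2) that])
  then have "x t \<in> cball 0 R" if "\<bar>t - t\<^sub>0\<bar> \<le> T" for t using that by (simp add: R_def x(1))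
  then have "\<forall>t. \<bar>t - t\<^sub>0\<bar> \<le> T \<longrightarrow> (x has_vector_derivative f (x t)) (at t)"
    using x(2) p_id by metis
  with x(1) show ?thesis by blast
qed

text \<open>The a priori estimate confines both solutions to a common ball; there one Lipschitz
  constant applies and Gronwall gives a difference of norm 0.\<close>

lemma ode_solution_unique:
  fixes f :: "'a::euclidean_space \<Rightarrow> 'a"
  assumes lip: "\<And>R. \<exists>L. \<forall>x\<in>cball 0 R. \<forall>y\<in>cball 0 R. norm (f x - f y) \<le> L * norm (x - y)"
    and C: "0 \<le> C" and f: "\<And>x. norm (f x) \<le> C * (1 + norm x)"
    and x: "\<And>t. \<bar>t - t\<^sub>0\<bar> \<le> T \<Longrightarrow> (x has_vector_derivative f (x t)) (at t)"
    and y: "\<And>t. \<bar>t - t\<^sub>0\<bar> \<le> T \<Longrightarrow> (y has_vector_derivative f (y t)) (at t)"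
    and eq: "x t\<^sub>0 = y t\<^sub>0" and t: "\<bar>t - t\<^sub>0\<bar> \<le> T"
  shows "x t = y t"
proof -
  define R where "R = exp (C * T) * (norm (x t\<^sub>0) + C * T)"
  have R: "x s \<in> cball 0 R" "y s \<in> cball 0 R" if "\<bar>s - t\<^sub>0\<bar> \<le> T" for s
    using linear_growth_a_priori[OF C f x that] linear_growth_a_priori[OF C f y that]
    by (auto simp: R_def eq)
  obtain L where L: "\<And>x y. x \<in> cball 0 R \<Longrightarrow> y \<in> cball 0 R \<Longrightarrow> norm (f x - f y) \<le> L * norm (x - y)"
    using lip by metis
  have "norm (x t - y t) \<le> exp (\<bar>L\<bar> * T) * (norm (x t\<^sub>0 - y t\<^sub>0) + 0 * T)"
  proof (rule gronwall[where z' = "\<lambda>t. f (x t) - f (y t)", OF _ _ _ _ t])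
    fix s assume s: "\<bar>s - t\<^sub>0\<bar> \<le> T"
    show "((\<lambda>s. x s - y s) has_vector_derivative f (x s) - f (y s)) (at s)"
      using x[OF s] y[OF s] by (rule has_vector_derivative_diff)
    show "norm (f (x s) - f (y s)) \<le> \<bar>L\<bar> * norm (x s - y s) + 0"
      using L[OF R[OF s]] mult_right_mono[OF abs_ge_self, of "norm (x s - y s)" L] by simp
  qed auto
  then show ?thesis by (simp add: eq)
qed

lemma ode_global_solution:
  fixes f :: "'a::euclidean_space \<Rightarrow> 'a"
  assumes lip: "\<And>R. \<exists>L. \<forall>x\<in>cball 0 R. \<forall>y\<in>cball 0 R. norm (f x - f y) \<le> L * norm (x - y)"
    and C: "0 \<le> C" and f: "\<And>x. norm (f x) \<le> C * (1 + norm x)"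
  shows "\<exists>x. x t\<^sub>0 = x\<^sub>0 \<and> (\<forall>t. (x has_vector_derivative f (x t)) (at t))"
proof -
  have "\<forall>k. \<exists>x. x t\<^sub>0 = x\<^sub>0 \<and>
      (\<forall>t. \<bar>t - t\<^sub>0\<bar> \<le> real k + 1 \<longrightarrow> (x has_vector_derivative f (x t)) (at t))"
    using ode_solution_interval[OF lip C f] by simp
  from choice[OF this] obtain X where X0: "\<And>k. X k t\<^sub>0 = x\<^sub>0"
    and X: "\<And>k t. \<bar>t - t\<^sub>0\<bar> \<le> real k + 1 \<Longrightarrow> (X k has_vector_derivative f (X k t)) (at t)" by blast
  have agree: "X j t = X m t" if "j \<le> m" "\<bar>t - t\<^sub>0\<bar> \<le> real j + 1" for j m t
    using that by (intro ode_solution_unique[OF lip C f X X _ that(2)]) (auto simp: X0)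
  define x where "x t = X (nat \<lceil>\<bar>t - t\<^sub>0\<bar>\<rceil>) t" for t
  have "(x has_vector_derivative f (x t)) (at t)" for t
  proof -
    \<comment> \<open>The extra 1 makes \<open>m\<close> at least the index that \<open>x\<close>
      selects at any point of the unit ball around \<open>t\<close>, so near \<open>t\<close> the
      glued function is the single solution \<open>X m\<close>.\<close>
    define m where "m = nat \<lceil>\<bar>t - t\<^sub>0\<bar>\<rceil> + 1"
    have x_eq: "X m s = x s" if "s \<in> ball t 1" for s
    proof -
      have "\<bar>s - t\<^sub>0\<bar> \<le> \<bar>t - t\<^sub>0\<bar> + 1" using that by (simp add: dist_real_def)
      then have "nat \<lceil>\<bar>s - t\<^sub>0\<bar>\<rceil> \<le> m" unfolding m_def by linarith
      moreover have "\<bar>s - t\<^sub>0\<bar> \<le> real (nat \<lceil>\<bar>s - t\<^sub>0\<bar>\<rceil>) + 1" by linarith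
      ultimately show ?thesis unfolding x_def by (rule agree[symmetric])
    qed
    have "\<bar>t - t\<^sub>0\<bar> \<le> real m + 1" unfolding m_def by linarith
    from X[OF this] have "(X m has_vector_derivative f (x t)) (at t)" by (simp add: x_eq)
    then show ?thesis
      by (rule has_vector_derivative_transform_within_open[of _ _ _ "ball t 1"]) (auto simp: x_eq)
  qed
  moreover have "x t\<^sub>0 = x\<^sub>0" by (simp add: x_def X0)
  ultimately show ?thesis by blast
qed

section \<open>The initial value problem on representatives\<close>

lemma quotient_class_eq:
  assumes "equiv A r" "U \<in> A // r" "u \<in> U"
  shows "U = r `` {u}"
  using assms by (metis Image_singleton_iff equiv_class_eq quotientE)

lemma UN_eq_const:
  assumes "\<And>a b. a \<in> A \<Longrightarrow> b \<in> B \<Longrightarrow> h a b = c" "A \<noteq> {}" "B \<noteq> {}"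
  shows "(\<Union>a\<in>A. \<Union>b\<in>B. h a b) = c"
  using assms by auto

lemma colombeau_vecD:
  assumes "F \<in> colombeau_vec" "represents f F"
  shows "component i f \<in> moderate" "g \<in> F $ i \<Longrightarrow> (component i f, g) \<in> colombeau_rel"
proof -
  have F: "F $ i \<in> moderate // colombeau_rel" "component i f \<in> F $ i"
    using assms by (auto simp: colombeau_vec_def colombeau_def represents_def)
  then show "component i f \<in> moderate"
    using in_quotient_imp_subset[OF equiv_colombeau_rel] by blast
  show "(component i f, g) \<in> colombeau_rel" if "g \<in> F $ i"
    using in_quotient_imp_in_rel[OF equiv_colombeau_rel F(1)] F(2) that by blast
qed

lemma c_bounded_colombeauD:
  assumes "X \<in> c_bounded_colombeau" "x \<in> X"
  shows "x \<in> c_bounded_nets" "y \<in> X \<Longrightarrow> (x, y) \<in> c_bounded_rel"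
  using assms in_quotient_imp_subset[OF equiv_c_bounded_rel]
    in_quotient_imp_in_rel[OF equiv_c_bounded_rel]
  unfolding c_bounded_colombeau_def by blast+

lemma colombeau_class_eq_iff:
  assumes "u \<in> moderate" "v \<in> moderate"
  shows "colombeau_class u = colombeau_class v \<longleftrightarrow> rapidly_small (\<lambda>\<epsilon> x. u \<epsilon> x - v \<epsilon> x)"
  unfolding colombeau_class_def eq_equiv_class_iff[OF equiv_colombeau_rel assms]
  using assms by (simp add: colombeau_rel_iff)

text \<open>Restricted to the index set because \<open>vector_derivative\<close> is arbitrary where
  the net is not differentiable. The second fact transfers what is known about
  \<open>partial_deriv\<close> to the derivative in the equation.\<close>

lemma c_bounded_nets_derivative:
  fixes x :: "(real, real ^ 'n) net"
  assumes "x \<in> c_bounded_nets" "\<epsilon> \<in> index_set"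
  shows "(x \<epsilon> has_vector_derivative vector_derivative (x \<epsilon>) (at t)) (at t)"
    and "component i (\<lambda>\<epsilon> t. vector_derivative (x \<epsilon>) (at t)) \<epsilon> t = partial_deriv [1] (component i x \<epsilon>) t"
proof -
  have "((\<lambda>t. x \<epsilon> t $ i) has_real_derivative partial_deriv [1] (component i x \<epsilon>) t) (at t)" for i
    using moderate_has_derivative[of "component i x" \<epsilon> t] assms
    by (simp add: c_bounded_nets_def component_def)
  then have d: "(x \<epsilon> has_vector_derivative (\<chi> i. partial_deriv [1] (component i x \<epsilon>) t)) (at t)"
    unfolding has_vector_derivative_vec_iff vec_lambda_beta by blast
  then have eq: "vector_derivative (x \<epsilon>) (at t) = (\<chi> i. partial_deriv [1] (component i x \<epsilon>) t)"
    by (rule vector_derivative_at)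
  show "(x \<epsilon> has_vector_derivative vector_derivative (x \<epsilon>) (at t)) (at t)"
    using d unfolding eq .
  show "component i (\<lambda>\<epsilon> t. vector_derivative (x \<epsilon>) (at t)) \<epsilon> t = partial_deriv [1] (component i x \<epsilon>) t"
    unfolding component_def[of i "\<lambda>\<epsilon> t. vector_derivative (x \<epsilon>) (at t)"] eq by (simp only: vec_lambda_beta)
qed

lemma moderate_vector_derivative:
  fixes x :: "(real, real ^ 'n) net"
  assumes "x \<in> c_bounded_nets"
  shows "component i (\<lambda>\<epsilon> t. vector_derivative (x \<epsilon>) (at t)) \<in> moderate"
proof (rule moderate_cong)
  have "component i x \<in> moderate" using assms by (simp add: c_bounded_nets_def)
  then show "(\<lambda>\<epsilon>. partial_deriv [1] (component i x \<epsilon>)) \<in> moderate"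
    by (rule moderate_partial_deriv) simp
qed (rule c_bounded_nets_derivative(2)[OF assms])

text \<open>The union in the definition collapses because members of one class have derivatives that
  differ by a negligible net, by \<open>rapidly_small_partial_deriv\<close>.\<close>

lemma generalized_deriv_eq:
  fixes X :: "(real, real ^ 'n) net set"
  assumes "X \<in> c_bounded_colombeau" "x \<in> X"
  shows "generalized_deriv X $ i = colombeau_class (component i (\<lambda>\<epsilon> t. vector_derivative (x \<epsilon>) (at t)))"
proof -
  have x: "x \<in> c_bounded_nets" using c_bounded_colombeauD[OF assms] by blast
  have "colombeau_class (component i (\<lambda>\<epsilon> t. vector_derivative (y \<epsilon>) (at t))) =
      colombeau_class (component i (\<lambda>\<epsilon> t. vector_derivative (x \<epsilon>) (at t)))" if "y \<in> X" for y
  proof -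
    have y: "y \<in> c_bounded_nets" using c_bounded_colombeauD[OF assms(1) that] by blast
    have mod: "component i y \<in> moderate" "component i x \<in> moderate"
      using x y by (simp_all add: c_bounded_nets_def)
    have "(y, x) \<in> c_bounded_rel" using c_bounded_colombeauD(2)[OF assms(1) that assms(2)] .
    then have "rapidly_small (component i (\<lambda>\<epsilon> t. y \<epsilon> t - x \<epsilon> t))"
      unfolding c_bounded_rel_iff rapidly_small_component by blast
    then have "rapidly_small (\<lambda>\<epsilon> t. component i y \<epsilon> t - component i x \<epsilon> t)"
      by (simp add: component_def)
    from rapidly_small_partial_deriv[OF moderate_diff[OF mod] this]
    have small: "rapidly_small (\<lambda>\<epsilon>. partial_deriv [1] (\<lambda>t. component i y \<epsilon> t - component i x \<epsilon> t))" .
    have "rapidly_small (\<lambda>\<epsilon> t. component i (\<lambda>\<epsilon> t. vector_derivative (y \<epsilon>) (at t)) \<epsilon> t -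
        component i (\<lambda>\<epsilon> t. vector_derivative (x \<epsilon>) (at t)) \<epsilon> t)"
    proof (rule rapidly_small_cong[OF small], rule eventually_mono[OF eventually_index_set], rule allI)
      fix \<epsilon> t :: real assume \<epsilon>: "\<epsilon> \<in> index_set"
      have "smooth (component i y \<epsilon>)" "smooth (component i x \<epsilon>)"
        using mod \<epsilon> by (simp_all add: moderate_iff)
      from partial_deriv_diff[OF this, of "[1]"]
      have "partial_deriv [1] (\<lambda>t. component i y \<epsilon> t - component i x \<epsilon> t) t =
          partial_deriv [1] (component i y \<epsilon>) t - partial_deriv [1] (component i x \<epsilon>) t"
        by (simp del: partial_deriv.simps)
      then show "component i (\<lambda>\<epsilon> t. vector_derivative (y \<epsilon>) (at t)) \<epsilon> t -
          component i (\<lambda>\<epsilon> t. vector_derivative (x \<epsilon>) (at t)) \<epsilon> t =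
          partial_deriv [1] (\<lambda>t. component i y \<epsilon> t - component i x \<epsilon> t) t"
        by (simp only: c_bounded_nets_derivative(2)[OF x \<epsilon>] c_bounded_nets_derivative(2)[OF y \<epsilon>])
    qed
    then show ?thesis
      unfolding colombeau_class_eq_iff[OF moderate_vector_derivative[OF y] moderate_vector_derivative[OF x]] .
  qed
  then have "(\<Union>y\<in>X. colombeau_class (component i (\<lambda>\<epsilon> t. vector_derivative (y \<epsilon>) (at t)))) =
      colombeau_class (component i (\<lambda>\<epsilon> t. vector_derivative (x \<epsilon>) (at t)))"
    using assms(2) by (intro UN_constant_eq ballI)
  then show ?thesis by (simp add: generalized_deriv_def)
qed

lemma moderate_component_compose:
  fixes F :: "(real ^ 'n, real) net set ^ 'n" and x :: "(real, real ^ 'n) net"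
  assumes "F \<in> colombeau_vec" "represents f F" "x \<in> c_bounded_nets"
  shows "component i (\<lambda>\<epsilon> t. f \<epsilon> (x \<epsilon> t)) \<in> moderate"
  using moderate_compose[OF colombeau_vecD(1)[OF assms(1,2)] assms(3)]
  by (simp add: component_def o_def)

text \<open>The union runs over all representatives, chosen independently for each component of
  \<open>F\<close>; \<open>rapidly_small_compose\<close> compares them with \<open>f\<close> and
  \<open>x\<close> in one step.\<close>

lemma gcompose_eq:
  fixes F :: "(real ^ 'n, real) net set ^ 'n" and X :: "(real, real ^ 'n) net set"
  assumes F: "F \<in> colombeau_vec" "represents f F" and X: "X \<in> c_bounded_colombeau" "x \<in> X"
  shows "gcompose F X $ i = colombeau_class (component i (\<lambda>\<epsilon> t. f \<epsilon> (x \<epsilon> t)))"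
proof -
  have x: "x \<in> c_bounded_nets" using c_bounded_colombeauD[OF X] by blast
  have "colombeau_class (\<lambda>\<epsilon>. g \<epsilon> \<circ> y \<epsilon>) = colombeau_class (component i (\<lambda>\<epsilon> t. f \<epsilon> (x \<epsilon> t)))"
    if "g \<in> F $ i" "y \<in> X" for g y
  proof -
    have g: "g \<in> moderate" "rapidly_small (\<lambda>\<epsilon> z. g \<epsilon> z - component i f \<epsilon> z)"
      using colombeau_vecD(2)[OF F that(1)] unfolding colombeau_rel_iff
      by (auto intro: rapidly_small_swap)
    have y: "y \<in> c_bounded_nets" "rapidly_small (\<lambda>\<epsilon> t. y \<epsilon> t - x \<epsilon> t)"
      using c_bounded_colombeauD[OF X(1) that(2)] X(2) by (auto simp: c_bounded_rel_iff)
    have "c_bounded x" "c_bounded y" using x y by (auto simp: c_bounded_nets_def)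
    from rapidly_small_compose[OF g this(2,1) y(2)]
    have "rapidly_small (\<lambda>\<epsilon> t. (g \<epsilon> \<circ> y \<epsilon>) t - component i (\<lambda>\<epsilon> t. f \<epsilon> (x \<epsilon> t)) \<epsilon> t)"
      by (simp add: component_def)
    then show ?thesis
      unfolding colombeau_class_eq_iff[OF moderate_compose[OF g(1) y(1)]
          moderate_component_compose[OF F x]] .
  qed
  moreover have "F $ i \<noteq> {}" "X \<noteq> {}" using F(2) X(2) by (auto simp: represents_def)
  ultimately have "(\<Union>g\<in>F $ i. \<Union>y\<in>X. colombeau_class (\<lambda>\<epsilon>. g \<epsilon> \<circ> y \<epsilon>)) =
      colombeau_class (component i (\<lambda>\<epsilon> t. f \<epsilon> (x \<epsilon> t)))"
    by (rule UN_eq_const)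
  then show ?thesis by (simp add: gcompose_def)
qed

lemma point_rel_iff:
  "(x, y) \<in> point_rel \<longleftrightarrow> x \<in> compact_nets \<and> y \<in> compact_nets \<and>
    (\<forall>q::nat. \<forall>\<^sub>F \<epsilon> in at_right 0. norm (x \<epsilon> - y \<epsilon>) \<le> \<epsilon> ^ q)"
proof -
  have "(\<forall>m::real. m > 0 \<longrightarrow> (\<lambda>\<epsilon>. norm (x \<epsilon> - y \<epsilon>)) \<in> O[at_right 0](\<lambda>\<epsilon>. \<epsilon> powr m)) \<longleftrightarrow>
      (\<forall>q::nat. \<forall>\<^sub>F \<epsilon> in at_right 0. norm (x \<epsilon> - y \<epsilon>) \<le> \<epsilon> ^ q)" (is "?L \<longleftrightarrow> ?R")
  proof
    assume L: ?L
    show ?R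
    proof
      fix q :: nat
      \<comment> \<open>\<open>Suc q\<close> serves twice: it is positive even for q = 0, as
        \<open>point_rel\<close> demands of its exponents, and it leaves a spare power to absorb
        \<open>c\<close>.\<close>
      have "(\<lambda>\<epsilon>. norm (x \<epsilon> - y \<epsilon>)) \<in> O[at_right 0](\<lambda>\<epsilon>. \<epsilon> powr real (Suc q))"
        using L by (simp del: of_nat_Suc)
      then obtain c where
        "\<forall>\<^sub>F \<epsilon> in at_right 0. norm (norm (x \<epsilon> - y \<epsilon>)) \<le> c * norm (\<epsilon> powr real (Suc q))"
        by (rule landau_o.bigE)
      then show "\<forall>\<^sub>F \<epsilon> in at_right 0. norm (x \<epsilon> - y \<epsilon>) \<le> \<epsilon> ^ q"
        using eventually_const_mult_power[of c q] eventually_index_set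
      proof eventually_elim
        case (elim \<epsilon>)
        then have "\<epsilon> powr real (Suc q) = \<epsilon> ^ Suc q" by (intro powr_realpow) simp
        with elim show ?case by (simp del: of_nat_Suc power_Suc)
      qed
    qed
  next
    assume R: ?R
    show ?L
    proof (intro allI impI)
      fix m :: real assume "m > 0"
      \<comment> \<open>Rounding the exponent up only strengthens the bound, since \<epsilon> \<le>
        1.\<close>
      have "\<forall>\<^sub>F \<epsilon> in at_right 0. norm (x \<epsilon> - y \<epsilon>) \<le> \<epsilon> ^ nat \<lceil>m\<rceil>" using R by blast
      then have "\<forall>\<^sub>F \<epsilon> in at_right 0. norm (norm (x \<epsilon> - y \<epsilon>)) \<le> 1 * norm (\<epsilon> powr m)"
        using eventually_index_set
      proof eventually_elim
        case (elim \<epsilon>)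
        have "\<epsilon> ^ nat \<lceil>m\<rceil> = \<epsilon> powr real (nat \<lceil>m\<rceil>)" using elim by (intro powr_realpow[symmetric]) simp
        also have "\<dots> \<le> \<epsilon> powr m" using elim by (intro powr_mono') (auto, linarith)
        finally show ?case using elim by simp
      qed
      then show "(\<lambda>\<epsilon>. norm (x \<epsilon> - y \<epsilon>)) \<in> O[at_right 0](\<lambda>\<epsilon>. \<epsilon> powr m)" by (rule bigoI)
    qed
  qed
  then show ?thesis unfolding point_rel_def mem_Collect_eq case_prod_conv by (intro conj_cong refl)
qed

lemma c_bounded_point:
  assumes "c_bounded x"
  shows "(\<lambda>\<epsilon>. x \<epsilon> t) \<in> compact_nets"
  using c_boundedD[OF assms compact_sing[of t]] unfolding compact_nets_def by simp blast

lemma point_value_eq: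
  fixes X :: "(real, real ^ 'n) net set"
  assumes "X \<in> c_bounded_colombeau" "x \<in> X"
  shows "point_value X t = point_rel `` {\<lambda>\<epsilon>. x \<epsilon> t}"
proof -
  have "point_rel `` {\<lambda>\<epsilon>. y \<epsilon> t} = point_rel `` {\<lambda>\<epsilon>. x \<epsilon> t}" if "y \<in> X" for y
  proof (rule equiv_class_eq[OF equiv_point_rel])
    have "(y, x) \<in> c_bounded_rel" using c_bounded_colombeauD(2)[OF assms(1) that assms(2)] .
    then have *: "c_bounded x" "c_bounded y" "rapidly_small (\<lambda>\<epsilon> t. y \<epsilon> t - x \<epsilon> t)"
      by (auto simp: c_bounded_rel_iff c_bounded_nets_def)
    have "\<forall>\<^sub>F \<epsilon> in at_right 0. \<forall>s\<in>{t}. norm (y \<epsilon> s - x \<epsilon> s) \<le> \<epsilon> ^ q" for q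
      using *(3) compact_sing[of t] unfolding rapidly_small_def by blast
    then have "\<forall>\<^sub>F \<epsilon> in at_right 0. norm (y \<epsilon> t - x \<epsilon> t) \<le> \<epsilon> ^ q" for q
      by simp
    then show "((\<lambda>\<epsilon>. y \<epsilon> t), (\<lambda>\<epsilon>. x \<epsilon> t)) \<in> point_rel"
      unfolding point_rel_iff using *(1,2) by (blast intro: c_bounded_point)
  qed
  with assms(2) show ?thesis unfolding point_value_def by (intro UN_constant_eq ballI)
qed

text \<open>Each of \<open>f\<close>, \<open>a\<close> and \<open>x\<close> may be any
  representative. Existence and uniqueness can thus use different representatives of
  \<open>F\<close>, one with the growth bound and one with the gradient bound.\<close>

lemma solves_ivp_iff:
  fixes F :: "(real ^ 'n, real) net set ^ 'n" and X :: "(real, real ^ 'n) net set"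
  assumes F: "F \<in> colombeau_vec" "represents f F"
    and x\<^sub>0: "x\<^sub>0 \<in> generalized_points" "a \<in> x\<^sub>0"
    and X: "X \<in> c_bounded_colombeau" "x \<in> X"
  shows "solves_ivp F t\<^sub>0 x\<^sub>0 X \<longleftrightarrow>
    rapidly_small (\<lambda>\<epsilon> t. vector_derivative (x \<epsilon>) (at t) - f \<epsilon> (x \<epsilon> t)) \<and>
    ((\<lambda>\<epsilon>. x \<epsilon> t\<^sub>0), a) \<in> point_rel"
proof -
  have x: "x \<in> c_bounded_nets" using c_bounded_colombeauD[OF X] by blast
  have "generalized_deriv X = gcompose F X \<longleftrightarrow>
      (\<forall>i. rapidly_small (\<lambda>\<epsilon> t. component i (\<lambda>\<epsilon> t. vector_derivative (x \<epsilon>) (at t)) \<epsilon> t -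
        component i (\<lambda>\<epsilon> t. f \<epsilon> (x \<epsilon> t)) \<epsilon> t))"
    unfolding vec_eq_iff generalized_deriv_eq[OF X] gcompose_eq[OF F X]
      colombeau_class_eq_iff[OF moderate_vector_derivative[OF x] moderate_component_compose[OF F x]] ..
  also have "\<dots> \<longleftrightarrow> rapidly_small (\<lambda>\<epsilon> t. vector_derivative (x \<epsilon>) (at t) - f \<epsilon> (x \<epsilon> t))"
    unfolding rapidly_small_component[of "\<lambda>\<epsilon> t. vector_derivative (x \<epsilon>) (at t) - f \<epsilon> (x \<epsilon> t)"]
    by (simp add: component_def)
  finally have 1: "generalized_deriv X = gcompose F X \<longleftrightarrow>
    rapidly_small (\<lambda>\<epsilon> t. vector_derivative (x \<epsilon>) (at t) - f \<epsilon> (x \<epsilon> t))" .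
  have a: "x\<^sub>0 = point_rel `` {a}" "a \<in> compact_nets"
    using x\<^sub>0 quotient_class_eq[OF equiv_point_rel] in_quotient_imp_subset[OF equiv_point_rel]
    unfolding generalized_points_def by blast+
  have "(\<lambda>\<epsilon>. x \<epsilon> t\<^sub>0) \<in> compact_nets" using x by (intro c_bounded_point) (simp add: c_bounded_nets_def)
  from eq_equiv_class_iff[OF equiv_point_rel this a(2)]
  have 2: "point_value X t\<^sub>0 = x\<^sub>0 \<longleftrightarrow> ((\<lambda>\<epsilon>. x \<epsilon> t\<^sub>0), a) \<in> point_rel"
    unfolding point_value_eq[OF X] a(1) .
  show ?thesis unfolding solves_ivp_def 1 2 using X(1) by blast
qed

section \<open>Uniqueness\<close>

text \<open>The norm on matrices is the Frobenius norm; Cauchy-Schwarz in each row shows that it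
  dominates the operator norm.\<close>

lemma norm_matrix_vector_mult_le:
  fixes A :: "real ^ 'n ^ 'm"
  shows "norm (A *v h) \<le> norm A * norm h"
proof -
  have "norm (A *v h) \<le> L2_set (\<lambda>i. norm (A $ i) * norm h) UNIV"
    unfolding norm_vec_def[of "A *v h"]
    by (rule L2_set_mono) (simp_all add: matrix_vector_mul_component Cauchy_Schwarz_ineq2)
  also have "\<dots> = norm A * norm h"
    unfolding norm_vec_def[of A] by (rule L2_set_left_distrib[symmetric]) simp
  finally show ?thesis .
qed

text \<open>\<open>jacobian\<close> is identified with the matrix of partial derivatives, whose
  entries are continuous by smoothness. Continuity gives meaning to the supremum in
  \<open>gradient_log_type\<close> and yields Lipschitz constants on balls.\<close>

lemma smooth_components_jacobian:
  fixes f :: "real ^ 'n \<Rightarrow> real ^ 'n"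
  assumes "\<And>i. smooth (\<lambda>z. f z $ i)"
  shows "(f has_derivative (\<lambda>h. jacobian f (at z) *v h)) (at z)"
    and "continuous_on S (\<lambda>z. jacobian f (at z))"
proof -
  let ?J = "\<lambda>z. \<chi> i j. partial_deriv [axis j 1] (\<lambda>z. f z $ i) z"
  have D: "(f has_derivative (\<lambda>h. ?J z *v h)) (at z)" for z
  proof -
    have "((\<lambda>z. f z \<bullet> axis i 1) has_derivative (\<lambda>h. (?J z *v h) \<bullet> axis i 1)) (at z)" for i
      using smooth_derivative_eq[OF assms[of i], of z]
      by (simp add: inner_axis matrix_vector_mult_def mult.commute del: partial_deriv.simps)
    then show ?thesis
      unfolding has_derivative_componentwise_within[of f] by (auto simp: Basis_vec_def)
  qed
  have J: "jacobian f (at z) = ?J z" for z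
    unfolding jacobian_def frechet_derivative_at[OF D, symmetric] by (rule matrix_of_matrix_vector_mul)
  show "(f has_derivative (\<lambda>h. jacobian f (at z) *v h)) (at z)" unfolding J by (rule D)
  show "continuous_on S (\<lambda>z. jacobian f (at z))"
    unfolding J using assms
    by (intro continuous_on_vec_lambda smooth_continuous) (simp_all add: axis_in_Basis_iff)
qed

lemma smooth_components_lipschitz:
  fixes f :: "real ^ 'n \<Rightarrow> real ^ 'n"
  assumes "\<And>i. smooth (\<lambda>z. f z $ i)" "convex S" "\<And>z. z \<in> S \<Longrightarrow> norm (jacobian f (at z)) \<le> B"
    and "x \<in> S" "y \<in> S"
  shows "norm (f x - f y) \<le> B * norm (x - y)"
proof (rule differentiable_bound[OF assms(2) _ _ assms(4,5)])
  fix z assume z: "z \<in> S"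
  show "(f has_derivative (\<lambda>h. jacobian f (at z) *v h)) (at z within S)"
    using smooth_components_jacobian(1)[OF assms(1)] by (rule has_derivative_at_withinI)
  show "onorm (\<lambda>h. jacobian f (at z) *v h) \<le> B"
  proof (rule onorm_bound)
    show "0 \<le> B" using assms(3)[OF z] norm_ge_zero order.trans by blast
    show "norm (jacobian f (at z) *v h) \<le> B * norm h" for h
      using norm_matrix_vector_mult_le[of "jacobian f (at z)" h]
        mult_right_mono[OF assms(3)[OF z] norm_ge_zero[of h]] by linarith
  qed
qed

lemma smooth_components_lipschitz_cball:
  fixes f :: "real ^ 'n \<Rightarrow> real ^ 'n"
  assumes "\<And>i. smooth (\<lambda>z. f z $ i)"
  shows "\<exists>L. \<forall>x\<in>cball 0 R. \<forall>y\<in>cball 0 R. norm (f x - f y) \<le> L * norm (x - y)"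
proof -
  have "compact ((\<lambda>z. jacobian f (at z)) ` cball 0 R)"
    using smooth_components_jacobian(2)[OF assms] by (intro compact_continuous_image) auto
  then obtain L where "\<And>z. z \<in> cball 0 R \<Longrightarrow> norm (jacobian f (at z)) \<le> L"
    by (meson bounded_iff compact_imp_bounded imageI)
  then show ?thesis using smooth_components_lipschitz[OF assms convex_cball] by blast
qed

text \<open>The logarithm is nonpositive on the index set, so the left side is
  \<open>\<epsilon> powr (- M)\<close>; \<open>M\<close> is rounded up to a natural
  exponent.\<close>

lemma exp_mult_abs_ln_le:
  assumes "0 \<le> M"
  shows "\<exists>m::nat. \<forall>\<epsilon>\<in>index_set. exp (M * \<bar>ln \<epsilon>\<bar>) \<le> 1 / \<epsilon> ^ m"
proof (intro exI ballI)
  fix \<epsilon> :: real assume \<epsilon>: "\<epsilon> \<in> index_set"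
  have "M * \<bar>ln \<epsilon>\<bar> \<le> real (nat \<lceil>M\<rceil>) * \<bar>ln \<epsilon>\<bar>" by (intro mult_right_mono) (linarith, simp)
  also have "\<dots> = - (real (nat \<lceil>M\<rceil>) * ln \<epsilon>)" using \<epsilon> by simp
  finally have "exp (M * \<bar>ln \<epsilon>\<bar>) \<le> exp (- (real (nat \<lceil>M\<rceil>) * ln \<epsilon>))" by simp
  also have "\<dots> = 1 / \<epsilon> ^ nat \<lceil>M\<rceil>"
    using \<epsilon> exp_of_nat_mult[of "nat \<lceil>M\<rceil>" "ln \<epsilon>"] by (simp add: exp_minus inverse_eq_divide del: of_nat_nat)
  finally show "exp (M * \<bar>ln \<epsilon>\<bar>) \<le> 1 / \<epsilon> ^ nat \<lceil>M\<rceil>" .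
qed

lemma represents_smooth:
  fixes F :: "(real ^ 'n, real) net set ^ 'n"
  assumes "F \<in> colombeau_vec" "represents f F" "\<epsilon> \<in> index_set"
  shows "smooth (\<lambda>z. f \<epsilon> z $ i)"
  using colombeau_vecD(1)[OF assms(1,2), of i] assms(3) by (simp add: moderate_iff component_def)

text \<open>Neither net solves the equation exactly: each has a negligible defect, and the initial
  values agree only up to a negligible error. Gronwall is therefore applied in its inhomogeneous
  form, with these errors taken small enough to beat its factor.\<close>

lemma solves_ivp_rapidly_small_diff:
  fixes F :: "(real ^ 'n, real) net set ^ 'n"
  assumes x\<^sub>0: "x\<^sub>0 \<in> generalized_points" and F: "F \<in> colombeau_vec" "gradient_log_type F"
    and X: "solves_ivp F t\<^sub>0 x\<^sub>0 X" "x \<in> X" and Y: "solves_ivp F t\<^sub>0 x\<^sub>0 Y" "y \<in> Y"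
  shows "rapidly_small (\<lambda>\<epsilon> t. x \<epsilon> t - y \<epsilon> t)"
proof (rule rapidly_smallI_const)
  fix K :: "real set" and q :: nat assume K: "compact K" "K \<noteq> {}"
  obtain f where f: "represents f F" and log: "\<And>K. compact K \<Longrightarrow> K \<noteq> {} \<Longrightarrow>
     (\<lambda>\<epsilon>. SUP x\<in>K. norm (jacobian (f \<epsilon>) (at x))) \<in> O[at_right 0](\<lambda>\<epsilon>. \<bar>ln \<epsilon>\<bar>)"
    using F(2) unfolding gradient_log_type_def by blast
  have cbc: "X \<in> c_bounded_colombeau" "Y \<in> c_bounded_colombeau"
    using X Y by (auto simp: solves_ivp_def)
  have nets: "x \<in> c_bounded_nets" "y \<in> c_bounded_nets"
    using c_bounded_colombeauD(1) cbc X(2) Y(2) by blast+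
  have cb: "c_bounded x" "c_bounded y" using nets by (auto simp: c_bounded_nets_def)
  obtain a where a: "a \<in> x\<^sub>0"
    using x\<^sub>0 in_quotient_imp_non_empty[OF equiv_point_rel] unfolding generalized_points_def by blast
  have x: "rapidly_small (\<lambda>\<epsilon> t. vector_derivative (x \<epsilon>) (at t) - f \<epsilon> (x \<epsilon> t))"
    "((\<lambda>\<epsilon>. x \<epsilon> t\<^sub>0), a) \<in> point_rel"
    using X(1) unfolding solves_ivp_iff[OF F(1) f x\<^sub>0 a cbc(1) X(2)] by blast+
  have y: "rapidly_small (\<lambda>\<epsilon> t. vector_derivative (y \<epsilon>) (at t) - f \<epsilon> (y \<epsilon> t))"
    "((\<lambda>\<epsilon>. y \<epsilon> t\<^sub>0), a) \<in> point_rel"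
    using Y(1) unfolding solves_ivp_iff[OF F(1) f x\<^sub>0 a cbc(2) Y(2)] by blast+
  have init: "((\<lambda>\<epsilon>. x \<epsilon> t\<^sub>0), (\<lambda>\<epsilon>. y \<epsilon> t\<^sub>0)) \<in> point_rel"
    using x(2) y(2) equiv_point_rel by (meson equivE symD transD)
  obtain T where T: "\<And>t. t \<in> K \<Longrightarrow> \<bar>t - t\<^sub>0\<bar> \<le> T"
    using compact_imp_bounded[OF K(1)] bounded_any_center[of K t\<^sub>0]
    by (auto simp: dist_real_def abs_minus_commute)
  have T0: "0 \<le> T" using T K(2) by fastforce
  \<comment> \<open>Gronwall starts at \<open>t\<^sub>0\<close>, so \<open>K\<close> is replaced by
    an interval centred there.\<close>
  define J where "J = {t\<^sub>0 - T..t\<^sub>0 + T}"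
  have J: "compact J" "t \<in> J \<longleftrightarrow> \<bar>t - t\<^sub>0\<bar> \<le> T" for t by (auto simp: J_def)
  obtain R1 R2 where R: "R1 > 0" "\<forall>\<^sub>F \<epsilon> in at_right 0. x \<epsilon> ` J \<subseteq> cball 0 R1"
    "\<forall>\<^sub>F \<epsilon> in at_right 0. y \<epsilon> ` J \<subseteq> cball 0 R2"
    using c_bounded_cball[OF cb(1) J(1)] c_bounded_cball[OF cb(2) J(1)] by metis
  define B where "B = cball (0::real^'n) (max R1 R2)"
  have B: "compact B" "convex B" "B \<noteq> {}" using R(1) by (auto simp: B_def)
  have "\<forall>\<^sub>F \<epsilon> in at_right 0. continuous_on B (\<lambda>z. norm (jacobian (f \<epsilon>) (at z)))"
    using eventually_index_set
  proof eventually_elim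
    case (elim \<epsilon>)
    from smooth_components_jacobian(2)[OF represents_smooth[OF F(1) f elim]]
    show ?case by (rule continuous_on_norm)
  qed
  from bigo_SUP_iff[OF B(1,3) this, of "\<lambda>\<epsilon>. \<bar>ln \<epsilon>\<bar>"] log[OF B(1,3)]
  obtain c where c: "\<forall>\<^sub>F \<epsilon> in at_right 0. \<forall>z\<in>B. norm (jacobian (f \<epsilon>) (at z)) \<le> c * \<bar>ln \<epsilon>\<bar>"
    by (simp only: abs_norm_cancel abs_abs) blast
  obtain m :: nat where m: "\<forall>\<epsilon>\<in>index_set. exp ((\<bar>c\<bar> * T) * \<bar>ln \<epsilon>\<bar>) \<le> 1 / \<epsilon> ^ m"
    using exp_mult_abs_ln_le[of "\<bar>c\<bar> * T"] T0 by auto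
  \<comment> \<open>The surplus \<open>m\<close> cancels the Gronwall factor
    \<open>1 / \<epsilon> ^ m\<close>.\<close>
  have "\<forall>\<^sub>F \<epsilon> in at_right 0. norm (x \<epsilon> t\<^sub>0 - y \<epsilon> t\<^sub>0) \<le> \<epsilon> ^ (m + q)"
    using init unfolding point_rel_iff by blast
  moreover have
    "\<forall>\<^sub>F \<epsilon> in at_right 0. \<forall>t\<in>J. norm (vector_derivative (x \<epsilon>) (at t) - f \<epsilon> (x \<epsilon> t)) \<le> \<epsilon> ^ (m + q)"
    "\<forall>\<^sub>F \<epsilon> in at_right 0. \<forall>t\<in>J. norm (vector_derivative (y \<epsilon>) (at t) - f \<epsilon> (y \<epsilon> t)) \<le> \<epsilon> ^ (m + q)"
    using x(1) y(1) J(1) unfolding rapidly_small_def by blast+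
  ultimately have "\<forall>\<^sub>F \<epsilon> in at_right 0. \<forall>t\<in>K. norm (x \<epsilon> t - y \<epsilon> t) \<le> (1 + 2 * T) * \<epsilon> ^ q"
    using R(2,3) c eventually_index_set
  proof eventually_elim
    case (elim \<epsilon>)
    \<comment> \<open>The constant of the O-estimate comes without a sign, while Gronwall asks for a
      nonnegative one.\<close>
    define L where "L = \<bar>c\<bar> * \<bar>ln \<epsilon>\<bar>"
    \<comment> \<open>One defect of size at most \<open>\<epsilon> ^ (m + q)\<close> for each of the
      two nets.\<close>
    define \<eta> where "\<eta> = 2 * \<epsilon> ^ (m + q)"
    show ?case
    proof
      fix t assume t: "t \<in> K"
      have "norm (x \<epsilon> t - y \<epsilon> t) \<le> exp (L * T) * (norm (x \<epsilon> t\<^sub>0 - y \<epsilon> t\<^sub>0) + \<eta> * T)"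
      proof (rule gronwall[where z' = "\<lambda>t. vector_derivative (x \<epsilon>) (at t) - vector_derivative (y \<epsilon>) (at t)"])
        show "0 \<le> L" unfolding L_def by (intro mult_nonneg_nonneg abs_ge_zero)
        show "0 \<le> \<eta>" using elim(7) by (simp add: \<eta>_def)
        show "\<bar>t - t\<^sub>0\<bar> \<le> T" using t by (rule T)
        show "((\<lambda>t. x \<epsilon> t - y \<epsilon> t) has_vector_derivative
            vector_derivative (x \<epsilon>) (at s) - vector_derivative (y \<epsilon>) (at s)) (at s)" for s
          by (intro has_vector_derivative_diff c_bounded_nets_derivative(1) nets elim(7))
        fix s assume "\<bar>s - t\<^sub>0\<bar> \<le> T"
        then have s: "s \<in> J" by (simp add: J)
        have inB: "x \<epsilon> s \<in> B" "y \<epsilon> s \<in> B" using elim(4,5) s by (force simp: B_def)+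
        have "norm (jacobian (f \<epsilon>) (at z)) \<le> L" if "z \<in> B" for z
          using elim(6) that mult_right_mono[OF abs_ge_self[of c], of "\<bar>ln \<epsilon>\<bar>"] unfolding L_def by fastforce
        then have "norm (f \<epsilon> (x \<epsilon> s) - f \<epsilon> (y \<epsilon> s)) \<le> L * norm (x \<epsilon> s - y \<epsilon> s)"
          by (rule smooth_components_lipschitz[OF represents_smooth[OF F(1) f elim(7)] B(2) _ inB])
        moreover have "norm (vector_derivative (x \<epsilon>) (at s) - f \<epsilon> (x \<epsilon> s)) \<le> \<epsilon> ^ (m + q)"
          "norm (vector_derivative (y \<epsilon>) (at s) - f \<epsilon> (y \<epsilon> s)) \<le> \<epsilon> ^ (m + q)"
          using elim(2,3) s by blast+
        \<comment> \<open>Triangle inequality through the values of the field along the two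
          paths.\<close>
        moreover have "norm (u' - v') \<le> norm (fu - fv) + norm (u' - fu) + norm (v' - fv)"
          for u' v' fu fv :: "real ^ 'n"
        proof -
          have "norm (u' - v') = norm (((fu - fv) + (u' - fu)) - (v' - fv))" by simp
          also have "\<dots> \<le> norm ((fu - fv) + (u' - fu)) + norm (v' - fv)" by (rule norm_triangle_ineq4)
          also have "\<dots> \<le> norm (fu - fv) + norm (u' - fu) + norm (v' - fv)"
            by (intro add_right_mono norm_triangle_ineq)
          finally show ?thesis .
        qed
        note this[of "vector_derivative (x \<epsilon>) (at s)" "vector_derivative (y \<epsilon>) (at s)"
            "f \<epsilon> (x \<epsilon> s)" "f \<epsilon> (y \<epsilon> s)"]
        ultimately show "norm (vector_derivative (x \<epsilon>) (at s) - vector_derivative (y \<epsilon>) (at s))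
            \<le> L * norm (x \<epsilon> s - y \<epsilon> s) + \<eta>"
          unfolding \<eta>_def by linarith
      qed
      also have "\<dots> \<le> (1 / \<epsilon> ^ m) * (\<epsilon> ^ (m + q) + \<eta> * T)"
      proof (intro mult_mono add_mono order.refl)
        show "exp (L * T) \<le> 1 / \<epsilon> ^ m" using m elim(7) by (simp add: L_def mult_ac)
        show "norm (x \<epsilon> t\<^sub>0 - y \<epsilon> t\<^sub>0) \<le> \<epsilon> ^ (m + q)" by (rule elim(1))
      qed (use elim(7) T0 in \<open>auto simp: \<eta>_def\<close>)
      also have "\<dots> = (1 + 2 * T) * \<epsilon> ^ q"
        using elim(7) by (simp add: \<eta>_def power_add field_simps)
      finally show "norm (x \<epsilon> t - y \<epsilon> t) \<le> (1 + 2 * T) * \<epsilon> ^ q" .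
    qed
  qed
  then show "\<exists>c. \<forall>\<^sub>F \<epsilon> in at_right 0. \<forall>t\<in>K. norm (x \<epsilon> t - y \<epsilon> t) \<le> c * \<epsilon> ^ q" by blast
qed

lemma solves_ivp_unique:
  fixes F :: "(real ^ 'n, real) net set ^ 'n"
  assumes "x\<^sub>0 \<in> generalized_points" "F \<in> colombeau_vec" "gradient_log_type F"
    and X: "solves_ivp F t\<^sub>0 x\<^sub>0 X" and Y: "solves_ivp F t\<^sub>0 x\<^sub>0 Y"
  shows "X = Y"
proof -
  have cbc: "X \<in> c_bounded_colombeau" "Y \<in> c_bounded_colombeau"
    using X Y by (auto simp: solves_ivp_def)
  then have q: "X \<in> c_bounded_nets // c_bounded_rel" "Y \<in> c_bounded_nets // c_bounded_rel"
    by (auto simp: c_bounded_colombeau_def)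
  obtain x y where xy: "x \<in> X" "y \<in> Y"
    using in_quotient_imp_non_empty[OF equiv_c_bounded_rel] q by blast
  have "(x, y) \<in> c_bounded_rel"
    unfolding c_bounded_rel_iff
    using c_bounded_colombeauD(1) cbc xy solves_ivp_rapidly_small_diff[OF assms(1-3) X xy(1) Y xy(2)] by blast
  then show ?thesis using quotient_eq_iff[OF equiv_c_bounded_rel q xy] by simp
qed

section \<open>Existence\<close>

lemma partial_deriv_0: "partial_deriv bs (\<lambda>x. 0) = (\<lambda>x. 0)"
  by (induction bs) simp_all

text \<open>Asymptotic estimates ignore the indices where \<open>P\<close> fails; only smoothness is
  demanded there, and the zero function is smooth.\<close>

lemma moderate_restrict:
  assumes u: "u \<in> moderate" and ev: "\<forall>\<^sub>F \<epsilon> in at_right 0. P \<epsilon>"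
  shows "(\<lambda>\<epsilon> x. if P \<epsilon> then u \<epsilon> x else 0) \<in> moderate"
    and "rapidly_small (\<lambda>\<epsilon> x. u \<epsilon> x - (if P \<epsilon> then u \<epsilon> x else 0))"
proof -
  have eq: "(\<lambda>x. if P \<epsilon> then u \<epsilon> x else 0) = (if P \<epsilon> then u \<epsilon> else (\<lambda>x. 0))" for \<epsilon> by simp
  have "smooth (\<lambda>x::'a. 0)" by (simp add: smooth_def partial_deriv_0)
  moreover have "moderately_bounded (\<lambda>\<epsilon>. partial_deriv bs (\<lambda>x. if P \<epsilon> then u \<epsilon> x else 0))"
    if bs: "set bs \<subseteq> Basis" for bs
    unfolding moderately_bounded_def
  proof (intro allI impI)
    fix K :: "'a set" assume "compact K"
    then obtain N :: nat where "\<forall>\<^sub>F \<epsilon> in at_right 0. \<forall>x\<in>K. norm (partial_deriv bs (u \<epsilon>) x) \<le> 1 / \<epsilon> ^ N"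
      using u bs unfolding moderate_iff moderately_bounded_def by blast
    then have "\<forall>\<^sub>F \<epsilon> in at_right 0. \<forall>x\<in>K.
        norm (partial_deriv bs (\<lambda>x. if P \<epsilon> then u \<epsilon> x else 0) x) \<le> 1 / \<epsilon> ^ N"
      using ev by eventually_elim simp
    then show "\<exists>N::nat. \<forall>\<^sub>F \<epsilon> in at_right 0. \<forall>x\<in>K.
        norm (partial_deriv bs (\<lambda>x. if P \<epsilon> then u \<epsilon> x else 0) x) \<le> 1 / \<epsilon> ^ N" by blast
  qed
  ultimately show "(\<lambda>\<epsilon> x. if P \<epsilon> then u \<epsilon> x else 0) \<in> moderate"
    using u unfolding moderate_iff by (simp add: eq)
  show "rapidly_small (\<lambda>\<epsilon> x. u \<epsilon> x - (if P \<epsilon> then u \<epsilon> x else 0))"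
    by (rule rapidly_small_cong[OF rapidly_small_0]) (use ev in \<open>auto elim: eventually_mono\<close>)
qed

text \<open>Cutting a representative off for large \<open>\<epsilon>\<close> makes its growth bound hold for every index.\<close>

lemma linear_growth_representative:
  fixes F :: "(real ^ 'n, real) net set ^ 'n"
  assumes F: "F \<in> colombeau_vec" "linear_growth F"
  obtains f C where "represents f F" "C > 0" "\<And>\<epsilon> x. norm (f \<epsilon> x) \<le> C * (1 + norm x)"
    "\<And>\<epsilon> i. smooth (\<lambda>x. f \<epsilon> x $ i)"
proof -
  obtain f C \<epsilon>\<^sub>0 where f: "represents f F" and C: "C > 0" and e: "\<epsilon>\<^sub>0 > 0"
    and growth: "\<forall>\<epsilon>\<in>index_set. \<epsilon> < \<epsilon>\<^sub>0 \<longrightarrow> (\<forall>x. norm (f \<epsilon> x) \<le> C * (1 + norm x))"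
    using F(2) unfolding linear_growth_def by blast
  \<comment> \<open>Outside the index set nothing is known about \<open>f\<close>; replacing it by 0
    there too lets the classical equation be solved for every real index.\<close>
  define P where "P \<epsilon> \<longleftrightarrow> \<epsilon> \<in> index_set \<and> \<epsilon> < \<epsilon>\<^sub>0" for \<epsilon>
  have ev: "\<forall>\<^sub>F \<epsilon> in at_right 0. P \<epsilon>"
    using eventually_index_set eventually_at_right_0_less[OF e]
    unfolding P_def by eventually_elim blast
  define g where "g \<epsilon> x = (if P \<epsilon> then f \<epsilon> x else 0)" for \<epsilon> x
  have comp: "component i g = (\<lambda>\<epsilon> x. if P \<epsilon> then component i f \<epsilon> x else 0)" for i
    by (auto simp: component_def g_def fun_eq_iff)
  have "component i g \<in> F $ i" for i
  proof -
    have mod: "component i f \<in> moderate" by (rule colombeau_vecD(1)[OF F(1) f])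
    have "F $ i = colombeau_rel `` {component i f}"
      using F(1) f unfolding colombeau_vec_def colombeau_def represents_def
      by (intro quotient_class_eq[OF equiv_colombeau_rel]) auto
    moreover have "(component i f, component i g) \<in> colombeau_rel"
      unfolding colombeau_rel_iff comp using mod moderate_restrict[OF mod ev] by blast
    ultimately show ?thesis by blast
  qed
  then have "represents g F" by (simp add: represents_def)
  moreover have "norm (g \<epsilon> x) \<le> C * (1 + norm x)" for \<epsilon> x
    using growth C by (auto simp: g_def P_def add_nonneg_nonneg)
  moreover have "smooth (\<lambda>x. g \<epsilon> x $ i)" for \<epsilon> i
  proof (cases "P \<epsilon>")
    case True
    then show ?thesis using represents_smooth[OF F(1) f] by (simp add: g_def P_def)
  next
    case False
    then show ?thesis by (simp add: g_def smooth_def partial_deriv_0)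
  qed
  ultimately show thesis using that C by blast
qed

lemma moderately_bounded_c_bounded:
  assumes "c_bounded x"
  shows "moderately_bounded (component i x)"
proof (rule moderately_boundedI_const)
  fix K :: "'a set" assume "compact K"
  then obtain R where "\<forall>\<^sub>F \<epsilon> in at_right 0. x \<epsilon> ` K \<subseteq> cball 0 R"
    using c_bounded_cball[OF assms] by metis
  then have "\<forall>\<^sub>F \<epsilon> in at_right 0. \<forall>t\<in>K. norm (component i x \<epsilon> t) \<le> R / \<epsilon> ^ 0"
  proof eventually_elim
    case (elim \<epsilon>)
    show ?case
    proof
      fix t assume "t \<in> K"
      then have "norm (x \<epsilon> t) \<le> R" using elim by auto
      then show "norm (component i x \<epsilon> t) \<le> R / \<epsilon> ^ 0"
        using component_le_norm_cart[of "x \<epsilon> t" i] by (simp add: component_def)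
    qed
  qed
  then show "\<exists>N c. \<forall>\<^sub>F \<epsilon> in at_right 0. \<forall>t\<in>K. norm (component i x \<epsilon> t) \<le> c / \<epsilon> ^ N" by blast
qed

text \<open>Bootstrapping: \<open>k\<close> moderate derivatives of \<open>x\<close> give \<open>k\<close> moderate derivatives of \<open>x' = f \<circ> x\<close>.\<close>

lemma ode_solution_moderate:
  fixes f :: "(real ^ 'n, real ^ 'n) net" and x :: "(real, real ^ 'n) net"
  assumes f: "\<And>i. component i f \<in> moderate" and x: "c_bounded x"
    and ode: "\<And>\<epsilon> t. \<epsilon> \<in> index_set \<Longrightarrow> (x \<epsilon> has_vector_derivative f \<epsilon> (x \<epsilon> t)) (at t)"
  shows "x \<in> c_bounded_nets"
proof -
  have D: "(component i x \<epsilon> has_real_derivative component i f \<epsilon> (x \<epsilon> t)) (at t)" if "\<epsilon> \<in> index_set" for \<epsilon> t i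
    using ode[OF that, of t] unfolding has_vector_derivative_vec_iff by (simp add: component_def)
  have "moderate_upto k (component i x)" for k i
  proof (induction k arbitrary: i)
    case 0
    have "continuous_on UNIV (component i x \<epsilon>)" if "\<epsilon> \<in> index_set" for \<epsilon>
      using D[OF that] by (intro continuous_at_imp_continuous_on ballI) (rule DERIV_isCont)
    then show ?case using moderately_bounded_c_bounded[OF x, of i] by simp
  next
    case (Suc k)
    have "moderate_upto k (\<lambda>\<epsilon>. component i f \<epsilon> \<circ> x \<epsilon>)"
      by (rule moderate_upto_compose[OF f x Suc.IH])
    moreover have "\<forall>\<epsilon>\<in>index_set. \<forall>t.
        (component i x \<epsilon> has_real_derivative (component i f \<epsilon> \<circ> x \<epsilon>) t) (at t)"
      using D by simp
    ultimately show ?case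
      unfolding moderate_upto.simps using moderately_bounded_c_bounded[OF x, of i]
      by (intro conjI exI[of _ "\<lambda>\<epsilon>. component i f \<epsilon> \<circ> x \<epsilon>"])
  qed
  then show ?thesis using x by (simp add: c_bounded_nets_def moderate_iff_moderate_upto)
qed

lemma solves_ivp_exists:
  fixes F :: "(real ^ 'n, real) net set ^ 'n"
  assumes x\<^sub>0: "x\<^sub>0 \<in> generalized_points" and F: "F \<in> colombeau_vec" "linear_growth F"
  shows "\<exists>X. solves_ivp F t\<^sub>0 x\<^sub>0 X"
proof -
  obtain f C where f: "represents f F" and C: "C > 0"
    and growth: "\<And>\<epsilon> x. norm (f \<epsilon> x) \<le> C * (1 + norm x)"
    and smooth: "\<And>\<epsilon> i. smooth (\<lambda>x. f \<epsilon> x $ i)"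
    using linear_growth_representative[OF F] by blast
  obtain a where a: "a \<in> x\<^sub>0" "a \<in> compact_nets"
    using x\<^sub>0 in_quotient_imp_non_empty[OF equiv_point_rel] in_quotient_imp_subset[OF equiv_point_rel]
    unfolding generalized_points_def by blast
  have "\<forall>\<epsilon>. \<exists>x. x t\<^sub>0 = a \<epsilon> \<and> (\<forall>t. (x has_vector_derivative f \<epsilon> (x t)) (at t))"
    using ode_global_solution[OF smooth_components_lipschitz_cball[OF smooth] less_imp_le[OF C] growth]
    by blast
  from choice[OF this] obtain x where init: "\<And>\<epsilon>. x \<epsilon> t\<^sub>0 = a \<epsilon>"
    and ode: "\<And>\<epsilon> t. (x \<epsilon> has_vector_derivative f \<epsilon> (x \<epsilon> t)) (at t)" by blast
  have "c_bounded x"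
  proof (rule c_boundedI)
    fix K :: "real set" assume "compact K"
    then obtain T where T: "\<And>t. t \<in> K \<Longrightarrow> \<bar>t - t\<^sub>0\<bar> \<le> T"
      using compact_imp_bounded bounded_any_center[of K t\<^sub>0]
      by (auto simp: dist_real_def abs_minus_commute)
    obtain K0 where "compact K0" and K0: "\<forall>\<^sub>F \<epsilon> in at_right 0. a \<epsilon> \<in> K0"
      using a(2) unfolding compact_nets_def by blast
    then obtain r where r: "\<And>z. z \<in> K0 \<Longrightarrow> norm z \<le> r"
      using compact_imp_bounded bounded_iff by metis
    \<comment> \<open>The initial values for all small \<epsilon> have norm at most
      \<open>r\<close>, so the radius does not depend on \<epsilon>.\<close>
    from K0 have "\<forall>\<^sub>F \<epsilon> in at_right 0. x \<epsilon> ` K \<subseteq> cball 0 (exp (C * T) * (r + C * T))"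
    proof eventually_elim
      case (elim \<epsilon>)
      have "norm (x \<epsilon> t) \<le> exp (C * T) * (r + C * T)" if "t \<in> K" for t
      proof -
        have "norm (x \<epsilon> t) \<le> exp (C * T) * (norm (x \<epsilon> t\<^sub>0) + C * T)"
          using T[OF that] C by (intro linear_growth_a_priori[where g = "f \<epsilon>"] growth ode) auto
        also have "\<dots> \<le> exp (C * T) * (r + C * T)"
          using r[OF elim] by (simp add: init)
        finally show ?thesis .
      qed
      then show ?case by auto
    qed
    then show "\<exists>K'. compact K' \<and> (\<forall>\<^sub>F \<epsilon> in at_right 0. x \<epsilon> ` K \<subseteq> K')"
      using compact_cball by blast
  qed
  then have x: "x \<in> c_bounded_nets"
    by (rule ode_solution_moderate[OF colombeau_vecD(1)[OF F(1) f] _ ode])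
  define X where "X = c_bounded_rel `` {x}"
  have X: "X \<in> c_bounded_colombeau" "x \<in> X"
    using x equiv_class_self[OF equiv_c_bounded_rel x]
    by (auto simp: X_def c_bounded_colombeau_def intro: quotientI)
  have "rapidly_small (\<lambda>\<epsilon> t. vector_derivative (x \<epsilon>) (at t) - f \<epsilon> (x \<epsilon> t))"
    by (simp add: vector_derivative_at[OF ode] rapidly_small_0)
  moreover have "((\<lambda>\<epsilon>. x \<epsilon> t\<^sub>0), a) \<in> point_rel"
    using a(2) by (simp add: init point_rel_def)
  ultimately have "solves_ivp F t\<^sub>0 x\<^sub>0 X"
    unfolding solves_ivp_iff[OF F(1) f x\<^sub>0 a(1) X] by blast
  then show ?thesis by blast
qed

text \<open>The derivative is the class of \<open>f\<close> composed with \<open>x\<close>, and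
  linear growth bounds this net wherever \<open>x\<close> is bounded. Since
  \<open>c_bounded_gf\<close> asks about every representative, the remaining ones are reached
  through a negligible difference.\<close>

lemma solves_ivp_derivative_c_bounded:
  fixes F :: "(real ^ 'n, real) net set ^ 'n"
  assumes F: "F \<in> colombeau_vec" "linear_growth F" and X: "solves_ivp F t\<^sub>0 x\<^sub>0 X"
  shows "c_bounded_gf (generalized_deriv X)"
proof -
  obtain f C where f: "represents f F" and C: "C > 0"
    and growth: "\<And>\<epsilon> x. norm (f \<epsilon> x) \<le> C * (1 + norm x)"
    by (rule linear_growth_representative[OF F]) (rule that)
  have cbc: "X \<in> c_bounded_colombeau" and D: "generalized_deriv X = gcompose F X"
    using X by (auto simp: solves_ivp_def)
  then obtain x where x: "x \<in> X"
    using in_quotient_imp_non_empty[OF equiv_c_bounded_rel] unfolding c_bounded_colombeau_def by blast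
  have nets: "x \<in> c_bounded_nets" using c_bounded_colombeauD(1)[OF cbc x] .
  define v where "v = (\<lambda>\<epsilon> t. f \<epsilon> (x \<epsilon> t))"
  have v: "component i v \<in> moderate" for i
    unfolding v_def by (rule moderate_component_compose[OF F(1) f nets])
  have deriv_class: "generalized_deriv X $ i = colombeau_rel `` {component i v}" for i
    unfolding D gcompose_eq[OF F(1) f cbc x] colombeau_class_def v_def ..
  have "generalized_deriv X \<in> colombeau_vec"
    using v by (simp add: colombeau_vec_def colombeau_def deriv_class quotientI)
  moreover have "c_bounded u" if u: "represents u (generalized_deriv X)" for u
  proof (rule c_boundedI)
    fix K :: "real set" assume K: "compact K"
    have "rapidly_small (\<lambda>\<epsilon> t. component i v \<epsilon> t - component i u \<epsilon> t)" for i
      using u by (simp add: represents_def deriv_class colombeau_rel_iff)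
    then have "rapidly_small (\<lambda>\<epsilon> t. v \<epsilon> t - u \<epsilon> t)"
      unfolding rapidly_small_component[of "\<lambda>\<epsilon> t. v \<epsilon> t - u \<epsilon> t"] by (simp add: component_def)
    \<comment> \<open>Exponent 0 already suffices: the difference is at most 1, which is the summand
      1 in the radius below.\<close>
    then have "\<forall>\<^sub>F \<epsilon> in at_right 0. \<forall>t\<in>K. norm (v \<epsilon> t - u \<epsilon> t) \<le> \<epsilon> ^ 0"
      using K unfolding rapidly_small_def by blast
    moreover obtain R where "\<forall>\<^sub>F \<epsilon> in at_right 0. x \<epsilon> ` K \<subseteq> cball 0 R"
      using c_bounded_cball[OF _ K] nets unfolding c_bounded_nets_def by blast
    ultimately have "\<forall>\<^sub>F \<epsilon> in at_right 0. u \<epsilon> ` K \<subseteq> cball 0 (C * (1 + R) + 1)"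
    proof eventually_elim
      case (elim \<epsilon>)
      have "norm (u \<epsilon> t) \<le> C * (1 + R) + 1" if "t \<in> K" for t
      proof -
        have "norm (x \<epsilon> t) \<le> R" using elim(2) that by auto
        then have "C * (1 + norm (x \<epsilon> t)) \<le> C * (1 + R)" using C by simp
        then have "norm (v \<epsilon> t) \<le> C * (1 + R)"
          using growth[of \<epsilon> "x \<epsilon> t"] unfolding v_def by linarith
        moreover have "norm (v \<epsilon> t - u \<epsilon> t) \<le> 1" using elim(1) that by simp
        ultimately show ?thesis using norm_triangle_ineq2[of "u \<epsilon> t" "v \<epsilon> t"]
          by (simp add: norm_minus_commute)
      qed
      then show ?case by auto
    qed
    then show "\<exists>K'. compact K' \<and> (\<forall>\<^sub>F \<epsilon> in at_right 0. u \<epsilon> ` K \<subseteq> K')"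
      using compact_cball by blast
  qed
  ultimately show ?thesis unfolding c_bounded_gf_def by blast
qed

theorem theorem3p1:
  fixes F :: "(real ^ 'n, real) net set ^ 'n"
    and t\<^sub>0 :: real
    and x\<^sub>0 :: "(real \<Rightarrow> real ^ 'n) set"
  assumes "x\<^sub>0 \<in> generalized_points"
    and "F \<in> colombeau_vec"
    and "linear_growth F"
    and "gradient_log_type F"
  shows "(\<exists>!X. solves_ivp F t\<^sub>0 x\<^sub>0 X) \<and>
    (\<forall>X. solves_ivp F t\<^sub>0 x\<^sub>0 X \<longrightarrow> c_bounded_gf (generalized_deriv X))"
  using solves_ivp_exists[OF assms(1-3)] solves_ivp_unique[OF assms(1,2,4)]
    solves_ivp_derivative_c_bounded[OF assms(2,3)]
  by blast

end
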